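(* For every integer $m>0$, the diameter $d_m$ of the level-$m$ cell graph $\Gamma_m$ of the projective octagasket satisfies $d_m\ge 2^{m-1}-1$.
   Context: Let $\rho=\frac{1}{2+\sqrt2}$ and for $n=0,\dots,7$ let $F_n(x,y)=\rho\,\bigl(x+(1+\sqrt2)\cos\frac{(5-2n)\pi}{8},\; y+(1+\sqrt2)\sin\frac{(5-2n)\pi}{8}\bigr)$. Let $P\subset\mathbb{R}^2$ be the closed filled regular octagon centered at the origin with vertices $V_0=\{(\cos\frac{(5-2n)\pi}{8},\sin\frac{(5-2n)\pi}{8}) : n=0,\dots,7\}$. For a word $w=(j_1,\dots,j_m)\in\{0,\dots,7\}^m$ put $F_w=F_{j_1}\circ\cdots\circ F_{j_m}$ and $P_w=F_w(P)$. The octagons $P_w$ have disjoint interiors and two of them can share a full edge. Level-$m$ cell graph $\Gamma_m$ ($m\ge1$): let $O_m=\bigcup_{|w|=m}P_w$. The complement $\mathbb{R}^2\setminus O_m$ has one unbounded component and finitely many bounded components (the central holes of cells, and the holes, called pseudo-cells, between neighbouring cells). Each component $H$ is centrally symmetric about a point $c_H$ (with $c_H=0$ for the unbounded one). Identify each point $x\in\partial H$ with its antipode $2c_H-x$, for every component $H$. After these identifications each of the 8 edges of each octagon $P_w$ is shared with exactly one other octagon. The $m$-cells are the $8^m$ octagons $P_w$; two distinct $m$-cells are adjacent in $\Gamma_m$ if they share at least one octagon edge after the identifications. A path of length $n$ in $\Gamma_m$ is a sequence $c_0c_1\cdots c_n$ of $m$-cells in which consecutive cells are adjacent and distinct. $D_m(w,v)$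 is the minimum length of a path with end points $w$ and $v$, and $d_m=\max_{w,v}D_m(w,v)$ is the diameter of $\Gamma_m$. *)

theory Defs
  imports "HOL-Analysis.Analysis"
begin

definition \<rho> :: real where
  "\<rho> = 1 / (2 + sqrt 2)"

text \<open>
  The corners of the octagon are numbered clockwise.  The formula has period 8 in \<open>n\<close>, so
  \<open>corner 8 = corner 0\<close>.
\<close>

definition corner :: "nat \<Rightarrow> real \<times> real" where
  "corner n = (cos ((5 - 2 * real n) * pi / 8), sin ((5 - 2 * real n) * pi / 8))"

definition F :: "nat \<Rightarrow> real \<times> real \<Rightarrow> real \<times> real" where
  "F n p = \<rho> *\<^sub>R (p + (1 + sqrt 2) *\<^sub>R corner n)"

definition octagon :: "(real \<times> real) set" where
  "octagon = convex hull (corner ` {..<8})"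

definition octagon_edge :: "nat \<Rightarrow> (real \<times> real) set" where
  "octagon_edge i = closed_segment (corner i) (corner (Suc i))"

primrec F_word :: "nat list \<Rightarrow> real \<times> real \<Rightarrow> real \<times> real" where
  "F_word [] = id"
| "F_word (j # w) = F j \<circ> F_word w"

definition words :: "nat \<Rightarrow> nat list set" where
  "words m = {w. length w = m \<and> set w \<subseteq> {..<8}}"

definition cell :: "nat list \<Rightarrow> (real \<times> real) set" where
  "cell w = F_word w ` octagon"

definition cell_edge :: "nat list \<Rightarrow> nat \<Rightarrow> (real \<times> real) set" where
  "cell_edge w i = F_word w ` octagon_edge i"

definition cell_union :: "nat \<Rightarrow> (real \<times> real) set" where
  "cell_union m = (\<Union>w\<in>words m. cell w)"

definition symmetric_about :: "(real \<times> real) set \<Rightarrow> real \<times> real \<Rightarrow> bool" where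
  "symmetric_about H c \<longleftrightarrow> (\<lambda>x. 2 *\<^sub>R c - x) ` H = H"

text \<open>
  The connected components of the complement of \<open>cell_union m\<close> are the unbounded one, the central
  holes and the pseudo-cells.  A component is bounded or has a bounded nonempty complement, so it
  has at most one centre of symmetry.
\<close>

definition antipodal :: "nat \<Rightarrow> real \<times> real \<Rightarrow> real \<times> real \<Rightarrow> bool" where
  "antipodal m x y \<longleftrightarrow>
     (\<exists>H \<in> components (- cell_union m). \<exists>c.
        symmetric_about H c \<and> x \<in> frontier H \<and> y = 2 *\<^sub>R c - x)"

definition glue :: "nat \<Rightarrow> real \<times> real \<Rightarrow> (real \<times> real) set" where
  "glue m x = {y. equivclp (antipodal m) x y}"

text \<open>
  A cell is represented by its word; distinct words of the same length give distinct octagons.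
  Two cells share an edge after the identifications if some edge of one and some edge of the
  other have the same image in the quotient.
\<close>

definition adjacent :: "nat \<Rightarrow> nat list \<Rightarrow> nat list \<Rightarrow> bool" where
  "adjacent m w v \<longleftrightarrow>
     w \<in> words m \<and> v \<in> words m \<and> w \<noteq> v \<and>
     (\<exists>i<8. \<exists>j<8. glue m ` cell_edge w i = glue m ` cell_edge v j)"

definition path_of_length :: "nat \<Rightarrow> nat \<Rightarrow> nat list list \<Rightarrow> bool" where
  "path_of_length m n cs \<longleftrightarrow>
     length cs = Suc n \<and> set cs \<subseteq> words m \<and> successively (adjacent m) cs"

definition cell_dist :: "nat \<Rightarrow> nat list \<Rightarrow> nat list \<Rightarrow> nat" where
  "cell_dist m w v = (LEAST n. \<exists>cs. path_of_length m n cs \<and> hd cs = w \<and> last cs = v)"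

definition diam :: "nat \<Rightarrow> nat" where
  "diam m = Max {cell_dist m w v | w v. w \<in> words m \<and> v \<in> words m}"

end

theory Submission
  imports Defs
begin

text \<open>
  There is a continuous function on the plane, the potential, that is constant on the closure of
  every component of the complement of \<open>cell_union m\<close>.  It is therefore invariant under all
  antipodal identifications, whatever the shape of the holes.  It varies by at most \<open>1 / 2 ^ m\<close> on
  every cell of level \<open>m\<close>, it vanishes outside the octagon, and it is \<open>1/2\<close> on the central hole.  A
  path of length \<open>n\<close> from an outer cell to a cell at the central hole thus satisfies
  \<open>1/2 \<le> (n + 1) / 2 ^ m\<close>.

  The potential is built by subdivision.  The corners of a cell carry the two end points of an
  interval, and these are halved in the next level: all corners at the central hole receive the
  midpoint \<open>c\<close> of the interval, and the two inner points and the notch of an edge receive the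
  average of the values at the two ends of that edge.  A subcell then has corner values in
  \<open>{v, c}\<close>, where \<open>v\<close> is the value at the corner that it shares with the cell.  A hole is
  surrounded by edges with equal values.
\<close>

section \<open>The octagon\<close>

lemma sqrt_2_mult_sqrt_2 [simp]: "sqrt 2 * (sqrt 2 * z) = 2 * z"
  by (simp flip: mult.assoc)

text \<open>Keeps indices in the form \<open>n + d\<close>, in which the corner identities are stated.\<close>

declare One_nat_def [simp del] add_2_eq_Suc' [simp del]

section \<open>Linear relations between the corners\<close>

lemma corner_add_polar:
  fixes n d
  defines "t \<equiv> (5 - 2 * real n) * pi / 8"
  shows "corner (n + d) = (cos (t - d * pi / 4), sin (t - d * pi / 4))"
proof -
  have "(5 - 2 * real (n + d)) * pi / 8 = t - d * pi / 4"
    by (simp add: t_def field_simps)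
  then show ?thesis by (simp only: corner_def)
qed

lemma corner_add_4: "corner (n + 4) = - corner n"
  using corner_add_polar[of n 4] corner_add_polar[of n 0] by simp

lemma corner_add_8: "corner (n + 8) = corner n"
  using corner_add_4[of "n + 4"] corner_add_4[of n] by (simp add: add.assoc)

lemma corner_add_2: "corner (n + 2) = sqrt 2 *\<^sub>R corner (n + 1) - corner n"
  using corner_add_polar[of n 0] corner_add_polar[of n 1] corner_add_polar[of n 2]
  by (simp add: cos_diff sin_diff cos_45 sin_45 algebra_simps)

text \<open>Neighbouring corners form a basis of the plane. With these formulas
  \<open>corner_simps\<close> turns vector identities between corners into polynomial identities in
  \<open>sqrt 2\<close>.\<close>

lemma corner_add:
  "corner (n + 3) = corner (n + 1) - sqrt 2 *\<^sub>R corner n"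
  "corner (n + 5) = - corner (n + 1)"
  "corner (n + 6) = corner n - sqrt 2 *\<^sub>R corner (n + 1)"
  "corner (n + 7) = sqrt 2 *\<^sub>R corner n - corner (n + 1)"
  "corner (n + 9) = corner (n + 1)"
proof -
  have s: "n + 3 = (n + 1) + 2" "n + 5 = (n + 1) + 4" "n + 6 = (n + 2) + 4"
    "n + 7 = (n + 3) + 4" "n + 9 = (n + 1) + 8" "(n + 1) + 1 = n + 2" by auto
  show 3: "corner (n + 3) = corner (n + 1) - sqrt 2 *\<^sub>R corner n"
    unfolding s(1) corner_add_2[of "n + 1"] s(6) by (simp add: corner_add_2[of n] prod_eq_iff algebra_simps)
  show "corner (n + 5) = - corner (n + 1)" unfolding s(2) by (rule corner_add_4)
  show "corner (n + 6) = corner n - sqrt 2 *\<^sub>R corner (n + 1)"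
    unfolding s(3) corner_add_4 by (simp add: corner_add_2[of n])
  show "corner (n + 7) = sqrt 2 *\<^sub>R corner n - corner (n + 1)"
    unfolding s(4) corner_add_4 3 by simp
  show "corner (n + 9) = corner (n + 1)" unfolding s(5) by (rule corner_add_8)
qed

lemmas corner_simps = corner_add_2 corner_add_4 corner_add_8 corner_add

lemma corner_mod: "corner (n mod 8) = corner n"
proof -
  have "corner (m + 8 * q) = corner m" for m q
    by (induction q) (simp_all add: corner_add_8 flip: add.assoc
        add: add.commute[of 8] add.left_commute[of _ 8])
  from this[of "n mod 8" "n div 8"] show ?thesis by simp
qed

section \<open>Inner products and coordinates along two neighbouring corners\<close>

lemma inner_corner_self: "corner n \<bullet> corner n = 1"
  by (simp add: corner_def flip: power2_eq_square)

lemma inner_corner_add_1: "corner n \<bullet> corner (n + 1) = sqrt 2 / 2"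
proof -
  define t where "t = (5 - 2 * real n) * pi / 8"
  have "corner n \<bullet> corner (n + 1) = cos (t - (t - pi / 4))"
    using corner_add_polar[of n 0] corner_add_polar[of n 1]
    unfolding t_def by (subst cos_diff) simp
  then show ?thesis by (simp add: cos_45)
qed

lemmas inner_corner = inner_corner_self inner_corner_add_1
  trans [OF inner_commute inner_corner_add_1]

lemma orthonormal_expansion:
  "x = (x \<bullet> corner n) *\<^sub>R corner n + (x \<bullet> corner (n + 2)) *\<^sub>R corner (n + 2)"
proof -
  define t where "t = (5 - 2 * real n) * pi / 8"
  have c: "corner n = (cos t, sin t)" "corner (n + 2) = (sin t, - cos t)"
    using corner_add_polar[of n 0] corner_add_polar[of n 2]
    by (simp_all add: t_def cos_diff sin_diff)
  obtain p q where x: "x = (p, q)" by force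
  have "cos t * cos t = 1 - sin t * sin t"
    using sin_cos_squared_add[of t] by (simp add: power2_eq_square)
  then have "cos t * (cos t * z) = z - sin t * (sin t * z)" for z
    by (metis left_diff_distrib mult.assoc mult_1)
  then show ?thesis
    unfolding c x by (simp add: algebra_simps)
qed

lemma coordinates:
  "x = (x \<bullet> corner n - x \<bullet> corner (n + 2)) *\<^sub>R corner n
     + (sqrt 2 * (x \<bullet> corner (n + 2))) *\<^sub>R corner (n + 1)"
  by (subst orthonormal_expansion[of x n]) (simp add: corner_add_2[of n] prod_eq_iff algebra_simps)

text \<open>Take a corner \<open>k\<close> that maximises the inner product with \<open>x\<close>.
  The sign of the component along \<open>corner (k + 2)\<close>, which is orthogonal to
  \<open>corner k\<close>, decides whether \<open>x\<close> lies in the sector after or before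
  \<open>corner k\<close>.\<close>

lemma sector_cover:
  obtains k \<alpha> \<beta> where "k < 8" "\<alpha> \<ge> 0" "\<beta> \<ge> 0" "x = \<alpha> *\<^sub>R corner k + \<beta> *\<^sub>R corner (k + 1)"
proof -
  have "\<exists>k\<in>{..<8}. \<forall>j\<in>{..<8}. x \<bullet> corner j \<le> x \<bullet> corner k"
    using obtains_MAX[of "{..<8::nat}" "\<lambda>k. x \<bullet> corner k"]
    by (metis (no_types, lifting) Max_ge finite_imageI finite_lessThan image_eqI lessThan_iff
        lessThan_empty_iff zero_neq_numeral)
  then obtain k where "k < 8" and "\<And>j. j < 8 \<Longrightarrow> x \<bullet> corner j \<le> x \<bullet> corner k" by auto
  then have max: "x \<bullet> corner j \<le> x \<bullet> corner k" for j
    by (metis corner_mod mod_less_divisor zero_less_numeral)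
  show thesis
  proof (cases "x \<bullet> corner (k + 2) \<ge> 0")
    case True
    then show thesis
      using that[OF \<open>k < 8\<close> _ _ coordinates[of x k]] max[of "k + 2"] by simp
  next
    case False
    \<comment> \<open>The sector before \<open>corner k\<close>: on indices, \<open>k + 7\<close>
      stands for \<open>k - 1\<close>.\<close>
    have c: "corner ((k + 7) mod 8) = corner (k + 7)"
      "corner ((k + 7) mod 8 + 1) = corner k"
      by (metis corner_mod)
        (metis corner_mod mod_add_left_eq corner_add_8 add.assoc one_plus_numeral
          semiring_norm(2,4,8) add.commute numeral_One add_One)
    have "x = (- sqrt 2 * q) *\<^sub>R corner (k + 7) + (p + q) *\<^sub>R corner k"
      if "x = (p - q) *\<^sub>R corner k + (sqrt 2 * q) *\<^sub>R corner (k + 1)" for p q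
      using that by (simp add: corner_simps prod_eq_iff algebra_simps)
    note this[OF coordinates]
    moreover have "x \<bullet> corner k + x \<bullet> corner (k + 2) \<ge> 0"
      using max[of "k + 2 + 4"] unfolding corner_add_4 by simp
    moreover have "- sqrt 2 * (x \<bullet> corner (k + 2)) \<ge> 0"
      using False by (simp add: mult_nonneg_nonpos)
    ultimately show thesis
      using that[of "(k + 7) mod 8"] c by fastforce
  qed
qed

section \<open>Piecewise linear functions on the fan of sectors\<close>

definition hat :: "nat \<Rightarrow> real \<times> real \<Rightarrow> real" where
  "hat i x = max 0 (x \<bullet> corner i - \<bar>x \<bullet> corner (i + 2)\<bar>)"

lemma sum_periodic:
  fixes f :: "nat \<Rightarrow> real"
  assumes "\<And>i. f (i + 8) = f i"
  shows "(\<Sum>i<8. f i) = (\<Sum>d<8. f (j + d))"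
proof (induction j)
  case (Suc j)
  have "(\<Sum>d<8. f (j + d)) = f j + (\<Sum>d<7. f (Suc j + d))"
    using sum.lessThan_Suc_shift[of "\<lambda>d. f (j + d)" 7] by simp
  also have "\<dots> = (\<Sum>d<8. f (Suc j + d))"
    using sum.lessThan_Suc[of "\<lambda>d. f (Suc j + d)" 7] assms[of j] by (simp add: add.commute)
  finally show ?case using Suc by simp
qed simp

lemma inner_sector:
  assumes "x = \<alpha> *\<^sub>R corner j + \<beta> *\<^sub>R corner (j + 1)"
  shows "x \<bullet> corner j = \<alpha> + sqrt 2 / 2 * \<beta>" "x \<bullet> corner (j + 1) = sqrt 2 / 2 * \<alpha> + \<beta>"
    "x \<bullet> corner (j + 2) = sqrt 2 / 2 * \<beta>" "x \<bullet> corner (j + 3) = - (sqrt 2 / 2 * \<alpha>)"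
    "x \<bullet> corner (j + 4) = - \<alpha> - sqrt 2 / 2 * \<beta>"
    "x \<bullet> corner (j + 5) = - (sqrt 2 / 2 * \<alpha>) - \<beta>"
    "x \<bullet> corner (j + 6) = - (sqrt 2 / 2 * \<beta>)" "x \<bullet> corner (j + 7) = sqrt 2 / 2 * \<alpha>"
    "x \<bullet> corner (j + 8) = \<alpha> + sqrt 2 / 2 * \<beta>"
    "x \<bullet> corner (j + 9) = sqrt 2 / 2 * \<alpha> + \<beta>"
proof -
  show 0: "x \<bullet> corner j = \<alpha> + sqrt 2 / 2 * \<beta>"
    and 1: "x \<bullet> corner (j + 1) = sqrt 2 / 2 * \<alpha> + \<beta>"
    unfolding assms by (simp_all add: inner_add_left inner_corner)
  show "x \<bullet> corner (j + 2) = sqrt 2 / 2 * \<beta>" "x \<bullet> corner (j + 3) = - (sqrt 2 / 2 * \<alpha>)"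
    "x \<bullet> corner (j + 4) = - \<alpha> - sqrt 2 / 2 * \<beta>"
    "x \<bullet> corner (j + 5) = - (sqrt 2 / 2 * \<alpha>) - \<beta>"
    "x \<bullet> corner (j + 6) = - (sqrt 2 / 2 * \<beta>)" "x \<bullet> corner (j + 7) = sqrt 2 / 2 * \<alpha>"
    "x \<bullet> corner (j + 8) = \<alpha> + sqrt 2 / 2 * \<beta>"
    "x \<bullet> corner (j + 9) = sqrt 2 / 2 * \<alpha> + \<beta>"
    unfolding corner_simps inner_diff_right inner_minus_right inner_scaleR_right 0 1
    by (simp_all add: field_simps)
qed

text \<open>\<open>hat i\<close> is the piecewise linear tent function with value 1 at
  \<open>corner i\<close> and 0 at the other seven corners. On a sector only the hats of its two
  corners survive, and they are the coordinates.\<close>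

lemma sum_hat:
  fixes f :: "nat \<Rightarrow> real"
  assumes f: "\<And>i. f (i + 8) = f i" and "\<alpha> \<ge> 0" "\<beta> \<ge> 0"
    and x: "x = \<alpha> *\<^sub>R corner j + \<beta> *\<^sub>R corner (j + 1)"
  shows "(\<Sum>i<8. f i * hat i x) = \<alpha> * f j + \<beta> * f (j + 1)"
proof -
  define A B where "A = sqrt 2 / 2 * \<alpha>" and "B = sqrt 2 / 2 * \<beta>"
  have nn: "A \<ge> 0" "B \<ge> 0" using assms by (auto simp: A_def B_def)
  note ins = inner_sector[OF x, folded A_def B_def]
  have h: "hat (j + 0) x = \<alpha>" "hat (j + 1) x = \<beta>" "hat (j + 2) x = 0" "hat (j + 3) x = 0"
    "hat (j + 4) x = 0" "hat (j + 5) x = 0" "hat (j + 6) x = 0" "hat (j + 7) x = 0"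
    using assms(2,3) nn by (simp_all add: hat_def add.assoc ins)
  have "(\<Sum>i<8. f i * hat i x) = (\<Sum>d<8. f (j + d) * hat (j + d) x)"
    by (rule sum_periodic) (simp add: f hat_def corner_add_8[of "_ + 2", simplified add.assoc, simplified]
        corner_add_8 add.assoc)
  moreover have "{..<8} = {0, 1, 2, 3, 4, 5, 6, 7::nat}" by auto
  ultimately show ?thesis by (simp add: h[simplified])
qed

text \<open>The Minkowski functional of the octagon, as \<open>octagon_iff_gauge\<close> confirms.
  In this form its continuity is evident.\<close>

definition gauge :: "real \<times> real \<Rightarrow> real" where
  "gauge x = (\<Sum>i<8. hat i x)"

lemma gauge_sector:
  assumes "\<alpha> \<ge> 0" "\<beta> \<ge> 0"
  shows "gauge (\<alpha> *\<^sub>R corner j + \<beta> *\<^sub>R corner (j + 1)) = \<alpha> + \<beta>"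
  using sum_hat[of "\<lambda>_. 1", OF _ assms refl] by (simp add: gauge_def)

lemma continuous_on_hat [continuous_intros]: "continuous_on S (hat i)"
  unfolding hat_def by (intro continuous_intros)

lemma continuous_on_gauge [continuous_intros]: "continuous_on S gauge"
  unfolding gauge_def by (intro continuous_intros)

section \<open>Membership in the octagon\<close>

lemma corner_in_octagon: "corner i \<in> octagon"
  by (metis corner_mod hull_inc image_eqI lessThan_iff mod_less_divisor octagon_def zero_less_numeral)

lemma convex_octagon: "convex octagon"
  by (simp add: octagon_def)

lemma closed_octagon: "closed octagon"
  unfolding octagon_def by (intro compact_imp_closed compact_convex_hull finite_imp_compact) auto

lemma zero_in_octagon: "0 \<in> octagon"
proof -
  have "(1/2) *\<^sub>R corner 0 + (1/2) *\<^sub>R corner (0 + 4) \<in> octagon"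
    by (intro convexD[OF convex_octagon] corner_in_octagon) auto
  then show ?thesis unfolding corner_add_4 by simp
qed

text \<open>The vector \<open>corner j + corner (j + 1)\<close> is normal to the edge between these
  corners. By minimality of the convex hull it suffices to check the eight corners.\<close>

lemma octagon_halfspace:
  assumes "z \<in> octagon"
  shows "z \<bullet> (corner j + corner (j + 1)) \<le> 1 + sqrt 2 / 2"
proof -
  define n where "n = corner j + corner (j + 1)"
  have "corner i \<bullet> n \<le> 1 + sqrt 2 / 2" for i
  proof -
    have "corner (j + d) \<bullet> n \<le> 1 + sqrt 2 / 2" if "d < 8" for d
    proof -
      have "d \<in> {0, 1, 2, 3, 4, 5, 6, 7}" using that by auto
      then show ?thesis
        using inner_sector[of n 1 j 1] by (auto simp: n_def inner_commute)
    qed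
    \<comment> \<open>This is the offset \<open>i - j\<close> modulo 8, since 7 is -1 modulo
      8.\<close>
    from this[of "(i + 7 * j) mod 8"]
    have "corner ((j + (i + 7 * j) mod 8) mod 8) \<bullet> n \<le> 1 + sqrt 2 / 2"
      unfolding corner_mod by simp
    also have "(j + (i + 7 * j) mod 8) mod 8 = (i + j * 8) mod 8"
      by (simp add: mod_add_right_eq algebra_simps)
    finally show ?thesis by (simp add: corner_mod)
  qed
  then have "corner ` {..<8} \<subseteq> {x. x \<bullet> n \<le> 1 + sqrt 2 / 2}" by auto
  moreover have "convex {x. x \<bullet> n \<le> 1 + sqrt 2 / 2}"
    using convex_halfspace_le[of n] by (simp add: inner_commute)
  ultimately have "octagon \<subseteq> {x. x \<bullet> n \<le> 1 + sqrt 2 / 2}"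
    unfolding octagon_def by (rule hull_minimal)
  then show ?thesis using assms by (auto simp: n_def)
qed

lemma octagon_sector_iff:
  assumes "\<alpha> \<ge> 0" "\<beta> \<ge> 0"
  shows "\<alpha> *\<^sub>R corner j + \<beta> *\<^sub>R corner (j + 1) \<in> octagon \<longleftrightarrow> \<alpha> + \<beta> \<le> 1"
    (is "?x \<in> _ \<longleftrightarrow> _")
proof
  assume "\<alpha> + \<beta> \<le> 1"
  then have "(\<alpha> + \<beta>) *\<^sub>R ((\<alpha> / (\<alpha> + \<beta>)) *\<^sub>R corner j + (\<beta> / (\<alpha> + \<beta>)) *\<^sub>R corner (j + 1))
      + (1 - \<alpha> - \<beta>) *\<^sub>R 0 \<in> octagon" if "\<alpha> + \<beta> \<noteq> 0"
    using assms that
    by (intro convexD[OF convex_octagon] corner_in_octagon zero_in_octagon)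
      (auto simp flip: add_divide_distrib)
  then show "?x \<in> octagon"
    using assms zero_in_octagon
    by (cases "\<alpha> + \<beta> = 0") (auto simp: scaleR_add_right add_nonneg_eq_0_iff)
next
  assume "?x \<in> octagon"
  then have "?x \<bullet> (corner j + corner (j + 1)) \<le> 1 + sqrt 2 / 2" by (rule octagon_halfspace)
  moreover have "?x \<bullet> (corner j + corner (j + 1)) = (1 + sqrt 2 / 2) * (\<alpha> + \<beta>)"
    unfolding inner_add_right inner_sector[OF refl] by (simp add: algebra_simps)
  moreover have "1 + sqrt 2 / 2 > 0" by (simp add: add_pos_nonneg)
  ultimately show "\<alpha> + \<beta> \<le> 1" by simp
qed

lemma octagon_iff_gauge: "x \<in> octagon \<longleftrightarrow> gauge x \<le> 1"
  by (metis sector_cover octagon_sector_iff gauge_sector)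

text \<open>Radial projection onto the octagon. It serves to extend a height from a cell to the
  points beyond its edges.\<close>

definition retract :: "real \<times> real \<Rightarrow> real \<times> real" where
  "retract x = x /\<^sub>R max 1 (gauge x)"

lemma continuous_on_retract: "continuous_on S retract"
  unfolding retract_def by (intro continuous_intros) auto

lemma retract_octagon: "x \<in> octagon \<Longrightarrow> retract x = x"
  by (simp add: octagon_iff_gauge retract_def)

lemma retract_sector:
  assumes "\<alpha> \<ge> 0" "\<beta> \<ge> 0" "\<alpha> + \<beta> \<ge> 1"
  shows "retract (\<alpha> *\<^sub>R corner j + \<beta> *\<^sub>R corner (j + 1))
    = (\<alpha> / (\<alpha> + \<beta>)) *\<^sub>R corner j + (1 - \<alpha> / (\<alpha> + \<beta>)) *\<^sub>R corner (j + 1)"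
proof -
  have "1 - \<alpha> / (\<alpha> + \<beta>) = \<beta> / (\<alpha> + \<beta>)" using assms by (simp add: field_simps)
  then show ?thesis
    using assms by (simp add: retract_def gauge_sector scaleR_add_right divide_inverse_commute)
qed

lemma retract_in_octagon: "retract x \<in> octagon"
proof (cases "x \<in> octagon")
  case False
  obtain k \<alpha> \<beta> where x: "\<alpha> \<ge> 0" "\<beta> \<ge> 0" "x = \<alpha> *\<^sub>R corner k + \<beta> *\<^sub>R corner (k + 1)"
    by (rule sector_cover)
  then have "\<alpha> + \<beta> > 1" using False octagon_sector_iff by auto
  then show ?thesis
    unfolding x(3) using x(1,2)
    by (subst retract_sector; (subst octagon_sector_iff)?) (auto simp: field_simps)
qed (simp add: retract_octagon)

section \<open>Wedges\<close>

text \<open>The factor \<open>sqrt 2 - 1\<close> is the tangent of \<open>pi / 8\<close>, so this is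
  the closed angular sector of opening \<open>pi / 4\<close> with axis through
  \<open>corner k\<close>. It contains the whole subcell at this corner, see
  \<open>F_in_wedge\<close>.\<close>

definition wedge :: "nat \<Rightarrow> (real \<times> real) set" where
  "wedge k = {x. \<bar>x \<bullet> corner (k + 2)\<bar> \<le> (sqrt 2 - 1) * (x \<bullet> corner k)}"

definition unF :: "nat \<Rightarrow> real \<times> real \<Rightarrow> real \<times> real" where
  "unF k x = (2 + sqrt 2) *\<^sub>R x - (1 + sqrt 2) *\<^sub>R corner k"

lemma sqrt_2_add_pos: "2 + sqrt 2 > 0" "sqrt 2 + 2 > 0"
  by (simp_all add: add_pos_nonneg)

lemma rho_simps: "(2 + sqrt 2) * \<rho> = 1" "\<rho> * (1 + sqrt 2) = 1 - \<rho>" "\<rho> > 0" "\<rho> < 1"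
proof -
  show 1: "(2 + sqrt 2) * \<rho> = 1" using sqrt_2_add_pos by (simp add: \<rho>_def)
  then show "\<rho> * (1 + sqrt 2) = 1 - \<rho>" by (simp add: algebra_simps)
  show "\<rho> > 0" "\<rho> < 1" using sqrt_2_add_pos by (simp_all add: \<rho>_def add_pos_nonneg)
qed

lemma F_eq: "F k z = \<rho> *\<^sub>R z + (1 - \<rho>) *\<^sub>R corner k"
  by (simp add: F_def scaleR_add_right rho_simps)

lemma unF_F: "unF k (F k z) = z"
  by (simp add: unF_def F_def rho_simps)

lemma F_unF: "F k (unF k x) = x"
  using rho_simps(1) by (simp add: unF_def F_def mult.commute)

lemma closed_wedge: "closed (wedge k)"
  unfolding wedge_def by (intro closed_Collect_le continuous_intros)

lemma wedge_mod: "wedge (k mod 8) = wedge k"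
  unfolding wedge_def corner_mod by (metis corner_mod mod_add_left_eq)

lemma wedge_sector_iff:
  fixes \<alpha> \<beta> :: real
  shows "\<alpha> *\<^sub>R corner k + \<beta> *\<^sub>R corner (k + 1) \<in> wedge k \<longleftrightarrow> \<beta> \<le> \<alpha> \<and> - \<beta> \<le> (sqrt 2 - 1) * \<alpha>"
    and "\<alpha> *\<^sub>R corner k + \<beta> *\<^sub>R corner (k + 1) \<in> wedge (k + 1)
      \<longleftrightarrow> \<alpha> \<le> \<beta> \<and> - \<alpha> \<le> (sqrt 2 - 1) * \<beta>"
proof -
  have main: "\<bar>sqrt 2 / 2 * \<beta>\<bar> \<le> (sqrt 2 - 1) * (\<alpha> + sqrt 2 / 2 * \<beta>)
    \<longleftrightarrow> \<beta> \<le> \<alpha> \<and> - \<beta> \<le> (sqrt 2 - 1) * \<alpha>" for \<alpha> \<beta> :: real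
  proof -
    have "sqrt 2 / 2 * \<beta> \<le> (sqrt 2 - 1) * (\<alpha> + sqrt 2 / 2 * \<beta>)
       \<longleftrightarrow> 0 \<le> (sqrt 2 - 1) * (\<alpha> - \<beta>)"
      by (simp add: field_simps) linarith
    also have "\<dots> \<longleftrightarrow> \<beta> \<le> \<alpha>" by (simp add: zero_le_mult_iff)
    finally have 1: "sqrt 2 / 2 * \<beta> \<le> (sqrt 2 - 1) * (\<alpha> + sqrt 2 / 2 * \<beta>) \<longleftrightarrow> \<beta> \<le> \<alpha>" .
    have "- (sqrt 2 / 2 * \<beta>) \<le> (sqrt 2 - 1) * (\<alpha> + sqrt 2 / 2 * \<beta>)
      \<longleftrightarrow> - \<beta> \<le> (sqrt 2 - 1) * \<alpha>"
      by (simp add: field_simps) linarith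
    with 1 show ?thesis by (auto simp: abs_le_iff)
  qed
  show "\<alpha> *\<^sub>R corner k + \<beta> *\<^sub>R corner (k + 1) \<in> wedge k \<longleftrightarrow> \<beta> \<le> \<alpha> \<and> - \<beta> \<le> (sqrt 2 - 1) * \<alpha>"
    unfolding wedge_def mem_Collect_eq inner_sector[OF refl] by (rule main)
  have 3: "k + 1 + 2 = k + 3" by simp
  show "\<alpha> *\<^sub>R corner k + \<beta> *\<^sub>R corner (k + 1) \<in> wedge (k + 1)
      \<longleftrightarrow> \<alpha> \<le> \<beta> \<and> - \<alpha> \<le> (sqrt 2 - 1) * \<beta>"
    unfolding wedge_def mem_Collect_eq 3 inner_sector[OF refl]
    using main[of \<alpha> \<beta>] by (simp add: add.commute)
qed

lemma wedge_cover: "\<exists>k<8. x \<in> wedge k"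
proof -
  obtain k \<alpha> \<beta> where "\<alpha> \<ge> 0" "\<beta> \<ge> 0" "x = \<alpha> *\<^sub>R corner k + \<beta> *\<^sub>R corner (k + 1)"
    by (rule sector_cover)
  moreover from this(1,2) have "- \<beta> \<le> (sqrt 2 - 1) * \<alpha>" "- \<alpha> \<le> (sqrt 2 - 1) * \<beta>"
    by (smt (verit) mult_nonneg_nonneg real_sqrt_ge_1_iff)+
  ultimately have "x \<in> wedge k \<or> x \<in> wedge (k + 1)"
    using wedge_sector_iff by (meson linear)
  then show ?thesis by (metis wedge_mod mod_less_divisor zero_less_numeral)
qed

text \<open>Let \<open>p\<close> and \<open>q\<close> be the orthogonal components along
  \<open>corner k\<close> and \<open>corner (k + 2)\<close>. If \<open>p\<close> were positive, then
  \<open>|q| < p\<close>, which contradicts the condition of each of the five other wedges.\<close>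

lemma wedge_Int_nonadjacent:
  assumes k: "x \<in> wedge k" and d: "x \<in> wedge (k + d)" "d \<in> {2, 3, 4, 5, 6}"
  shows "x = 0"
proof -
  define p q c where "p = x \<bullet> corner k" and "q = x \<bullet> corner (k + 2)" and "c = sqrt 2 - 1"
  have c: "0 < c" "c < 1"
    unfolding c_def using real_sqrt_less_iff[of 2 4] by (auto simp del: real_sqrt_less_iff)
  have x: "x = (p - q) *\<^sub>R corner k + (sqrt 2 * q) *\<^sub>R corner (k + 1)"
    unfolding p_def q_def by (rule coordinates)
  define s where "s = sqrt 2 / 2"
  have s: "s > 0" by (simp add: s_def)
  have in2: "x \<bullet> corner (k + 3) = s * (q - p)" "x \<bullet> corner (k + 4) = - p"
    "x \<bullet> corner (k + 5) = - (s * (p + q))" "x \<bullet> corner (k + 6) = - q"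
    "x \<bullet> corner (k + 7) = s * (p - q)" "x \<bullet> corner (k + 8) = p"
    unfolding inner_sector[OF x] s_def by (simp_all add: field_simps)
  have 1: "\<bar>q\<bar> \<le> c * p" using k by (simp add: wedge_def p_def q_def c_def)
  have "0 \<le> p" using 1 c by (smt (verit) mult_pos_neg)
  then have 2: "c * p \<le> p" using c by (simp add: mult_left_le_one_le)
  have sc: "\<bar>s * u\<bar> \<le> c * (s * v) \<longleftrightarrow> \<bar>u\<bar> \<le> c * v" for u v
    using s by (simp add: abs_mult mult.left_commute)
  have "p = 0"
  proof (rule ccontr)
    assume "p \<noteq> 0"
    then have "c * p < p" "0 < p" using c \<open>0 \<le> p\<close> by auto
    have d': "\<bar>x \<bullet> corner (k + (d + 2))\<bar> \<le> c * (x \<bullet> corner (k + d))"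
      using d(1) by (simp add: wedge_def c_def add.assoc)
    have neg: "c * u \<le> 0" if "u \<le> 0" for u using c that by (simp add: mult_nonneg_nonpos)
    have le: "c * q \<le> \<bar>q\<bar>" using c by (smt (verit) mult_left_le_one_le neg)
    consider "d = 2" | "d = 3" | "d = 4" | "d = 5" | "d = 6" using d(2) by auto
    then show False
    proof cases
      case 1
      with d' \<open>0 < p\<close> \<open>c * p < p\<close> le \<open>\<bar>q\<bar> \<le> c * p\<close> show False
        by (simp add: in2 q_def[symmetric])
    next
      case 2
      have "\<bar>- (s * (p + q))\<bar> \<le> c * (s * (q - p))" using d' by (simp add: 2 in2)
      then have "\<bar>p + q\<bar> \<le> c * (q - p)" using sc[of "p + q" "q - p"] by simp
      then show False using neg[of "q - p"] \<open>c * p < p\<close> 1 by linarith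
    next
      case 3
      with d' have "\<bar>q\<bar> \<le> c * - p" by (simp add: in2)
      then show False using c \<open>0 < p\<close> by (smt (verit) mult_pos_neg)
    next
      case 4
      have "\<bar>s * (p - q)\<bar> \<le> c * (s * - (p + q))" using d' by (simp add: 4 in2 algebra_simps)
      then have "\<bar>p - q\<bar> \<le> c * - (p + q)" unfolding sc .
      then show False using neg[of "- (p + q)"] \<open>c * p < p\<close> 1 by linarith
    next
      case 5
      have "\<bar>p\<bar> \<le> - (c * q)" using d' by (simp add: 5 in2)
      moreover have "- (c * q) \<le> \<bar>q\<bar>"
        using c by (smt (verit) mult_left_le_one_le mult_minus_right mult_pos_pos)
      ultimately show False using \<open>c * p < p\<close> 1 by linarith
    qed
  qed
  with 1 show ?thesis by (subst x) simp
qed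

lemma wedge_Int_adjacent:
  assumes "x \<in> wedge k" "x \<in> wedge (k + 1)"
  obtains t where "t \<ge> 0" "x = t *\<^sub>R corner k + t *\<^sub>R corner (k + 1)"
proof -
  obtain \<alpha> \<beta> where x: "x = \<alpha> *\<^sub>R corner k + \<beta> *\<^sub>R corner (k + 1)"
    using coordinates by blast
  have 1: "\<alpha> = \<beta>" "- \<alpha> \<le> (sqrt 2 - 1) * \<alpha>"
    using assms unfolding x wedge_sector_iff by auto
  then have "0 \<le> sqrt 2 * \<alpha>" by (simp add: algebra_simps)
  then have "\<alpha> \<ge> 0" by (simp add: zero_le_mult_iff)
  then show thesis using that x 1 by blast
qed

section \<open>Position of the subcells\<close>

lemma F_in_octagon: "z \<in> octagon \<Longrightarrow> F k z \<in> octagon"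
  unfolding F_eq using rho_simps by (intro convexD[OF convex_octagon] corner_in_octagon) auto

text \<open>\<open>F k\<close> maps the edges \<open>k + 2\<close> and \<open>k + 5\<close> of the
  octagon into the two lines that bound \<open>wedge k\<close>. The half-planes of these edges
  therefore yield the two wedge inequalities.\<close>

lemma F_in_wedge:
  assumes "z \<in> octagon"
  shows "F k z \<in> wedge k"
proof -
  define p q where "p = z \<bullet> corner k" and "q = z \<bullet> corner (k + 2)"
  have z: "z = (p - q) *\<^sub>R corner k + (sqrt 2 * q) *\<^sub>R corner (k + 1)"
    unfolding p_def q_def by (rule coordinates)
  have "z \<bullet> corner (k + 2) + z \<bullet> corner (k + 3) \<le> 1 + sqrt 2 / 2"
    "z \<bullet> corner (k + 5) + z \<bullet> corner (k + 6) \<le> 1 + sqrt 2 / 2"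
    using octagon_halfspace[OF assms, of "k + 2"] octagon_halfspace[OF assms, of "k + 5"]
    by (simp_all add: inner_add_right add.assoc)
  then have "(1 + sqrt 2 / 2) * (q - (sqrt 2 - 1) * p) \<le> (1 + sqrt 2 / 2) * 1"
    "(1 + sqrt 2 / 2) * (- q - (sqrt 2 - 1) * p) \<le> (1 + sqrt 2 / 2) * 1"
    unfolding inner_sector[OF z] by (simp_all add: field_simps)
  moreover have "1 + sqrt 2 / 2 > 0" by (simp add: add_pos_nonneg)
  ultimately have "\<bar>q\<bar> \<le> (sqrt 2 - 1) * p + 1"
    by (simp add: abs_le_iff)
  also have "\<dots> = (sqrt 2 - 1) * (p + (1 + sqrt 2))" by (simp add: algebra_simps)
  finally have "\<rho> * \<bar>q\<bar> \<le> \<rho> * ((sqrt 2 - 1) * (p + (1 + sqrt 2)))"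
    using rho_simps by simp
  moreover have "corner k \<bullet> corner (k + 2) = 0"
    using inner_sector[of "corner k" 1 k 0] by simp
  ultimately show ?thesis
    using rho_simps(3)
    by (simp add: wedge_def F_def inner_add_left inner_corner abs_mult p_def q_def mult.left_commute)
qed

section \<open>A height function that is constant around every hole\<close>

text \<open>
  Values are normalised to the unit interval, so corner values are Booleans.  The subcell at a corner
  with value 1 is reflected by \<open>flip\<close>, so that its value at this corner is 0 in every case.
\<close>

definition flip :: "bool \<Rightarrow> real \<Rightarrow> real" where
  "flip p z = (if p then 1 - z / 2 else z / 2)"

text \<open>After normalisation \<open>True\<close> encodes the midpoint value. The offset
  \<open>d\<close> is \<open>i - k\<close> modulo 8: offsets 1 and 2 are the inner point and the
  notch on one side, 3 to 5 the corners at the central hole, 6 and 7 the notch and the inner point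
  on the other side. Two Boolean end values have the midpoint as average exactly if they
  differ.\<close>

definition child :: "(nat \<Rightarrow> bool) \<Rightarrow> nat \<Rightarrow> nat \<Rightarrow> bool" where
  "child a k i = (let d = (i + 7 * k) mod 8 in
     if d = 0 then False else if d \<le> 2 then a k \<noteq> a (k + 1)
     else if d \<le> 5 then True else a k \<noteq> a (k + 7))"

text \<open>\<open>retract\<close> extends the height of a subcell to the rest of its wedge. On a
  ray between two wedges the choice is arbitrary; \<open>piece_agree\<close> shows that it does not
  affect the value on the octagon.\<close>

primrec height :: "nat \<Rightarrow> (nat \<Rightarrow> bool) \<Rightarrow> real \<times> real \<Rightarrow> real" where
  "height 0 a x = (\<Sum>i<8. of_bool (a i) * hat i x)"
| "height (Suc m) a x =
    (let k = SOME k. k < 8 \<and> x \<in> wedge k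
     in flip (a k) (height m (child a k) (retract (unF k x))))"

definition edge_child :: "real \<Rightarrow> real" where
  "edge_child l = max 0 ((2 + sqrt 2) * l - (1 + sqrt 2))"

text \<open>The profile of the height along an edge, a finite stage of a Cantor-type function;
  \<open>l\<close> is the weight of the end with value \<open>p\<close>. \<open>edge_child\<close>
  rescales the part of the edge that a subcell covers and is clipped to 0 over the gap.\<close>

primrec edge_height :: "nat \<Rightarrow> bool \<Rightarrow> bool \<Rightarrow> real \<Rightarrow> real" where
  "edge_height 0 p q l = l * of_bool p + (1 - l) * of_bool q"
| "edge_height (Suc m) p q l =
    (if l \<ge> 1/2 then flip p (edge_height m False (p \<noteq> q) (edge_child l))
     else flip q (edge_height m (p \<noteq> q) False (1 - edge_child (1 - l))))"

definition periodic :: "(nat \<Rightarrow> bool) \<Rightarrow> bool" where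
  "periodic a \<longleftrightarrow> (\<forall>i. a (i + 8) = a i)"

definition piece :: "nat \<Rightarrow> (nat \<Rightarrow> bool) \<Rightarrow> nat \<Rightarrow> real \<times> real \<Rightarrow> real" where
  "piece m a k x = flip (a k) (height m (child a k) (retract (unF k x)))"

section \<open>Corner values and edge profiles\<close>

lemma flip_of_bool: "flip p (of_bool q) = (if q then 1/2 else of_bool p)"
  by (simp add: flip_def)

lemma flip_0_1 [simp]: "flip p 0 = of_bool p" "flip p 1 = 1/2"
  by (simp_all add: flip_def)

lemma periodicD: "periodic a \<Longrightarrow> a (i + 8) = a i"
  by (simp add: periodic_def)

lemma periodic_mod:
  assumes "periodic a"
  shows "a (i mod 8) = a i"
proof -
  have "a (i + 8 * q) = a i" for i q
    by (induction q) (simp_all add: periodicD[OF assms] flip: add.assoc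
        add: add.commute[of 8] add.left_commute[of _ 8])
  from this[of "i mod 8" "i div 8"] show ?thesis by simp
qed

lemma periodic_child: "periodic (child a k)"
proof -
  have "(i + 8 + 7 * k) mod 8 = (i + 7 * k) mod 8" for i
    using mod_add_self2[of "i + 7 * k" 8] by (simp add: algebra_simps)
  then show ?thesis unfolding periodic_def child_def by simp
qed

lemma child_mod:
  assumes "periodic a"
  shows "child a (k mod 8) = child a k"
proof
  fix i
  have 1: "(i + 7 * (k mod 8)) mod 8 = (i + 7 * k) mod 8"
    by (metis mod_add_right_eq mod_mult_right_eq)
  have 2: "a (k mod 8 + d) = a (k + d)" for d
    by (metis assms mod_add_left_eq periodic_mod)
  show "child a (k mod 8) i = child a k i"
    unfolding child_def 1 2 periodic_mod[OF assms] ..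
qed

lemma child_simps:
  "\<not> child a k k" "child a k (k + 1) \<longleftrightarrow> a k \<noteq> a (k + 1)" "child a k (k + 2) \<longleftrightarrow> a k \<noteq> a (k + 1)"
  "child a k (k + 3)" "child a k (k + 4)" "child a k (k + 5)"
  "child a k (k + 6) \<longleftrightarrow> a k \<noteq> a (k + 7)" "child a k (k + 7) \<longleftrightarrow> a k \<noteq> a (k + 7)"
  "\<not> child a k (k + 8)"
proof -
  have "(k + d + 7 * k) mod 8 = d mod 8" for d
    using mod_mult_self1[of d k 8] by (simp add: algebra_simps)
  note this[simp] this[of 0, simplified, simp]
  show "\<not> child a k k" "child a k (k + 1) \<longleftrightarrow> a k \<noteq> a (k + 1)"
    "child a k (k + 2) \<longleftrightarrow> a k \<noteq> a (k + 1)"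
    "child a k (k + 3)" "child a k (k + 4)" "child a k (k + 5)"
    "child a k (k + 6) \<longleftrightarrow> a k \<noteq> a (k + 7)" "child a k (k + 7) \<longleftrightarrow> a k \<noteq> a (k + 7)"
    "\<not> child a k (k + 8)"
    by (simp_all add: child_def)
qed

lemma edge_child_half: "l \<le> 1/2 \<Longrightarrow> edge_child l = 0"
proof -
  assume "l \<le> 1/2"
  then have "(2 + sqrt 2) * l \<le> (2 + sqrt 2) * (1/2)"
    by (intro mult_left_mono) auto
  also have "\<dots> \<le> 1 + sqrt 2" by (simp add: field_simps)
  finally show ?thesis unfolding edge_child_def by simp
qed

lemma edge_child_1: "edge_child 1 = 1"
  by (simp add: edge_child_def)

text \<open>Equal end values pass to the subcells as two values \<open>False\<close>. Edges around a
  hole are of this kind.\<close>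

lemma edge_height_refl: "edge_height m p p l = of_bool p"
  by (induction m arbitrary: p l) (auto simp: of_bool_def)

lemma edge_height_ends: "edge_height m p q 0 = of_bool q" "edge_height m p q 1 = of_bool p"
  by (induction m arbitrary: p q) (auto simp: edge_child_1 simp del: of_bool_eq_iff)

lemma edge_height_sym: "edge_height m p q l = edge_height m q p (1 - l)"
proof (induction m arbitrary: p q l)
  case (Suc m)
  have *: "edge_height (Suc m) p q l = edge_height (Suc m) q p (1 - l)" if "l > 1/2" for p q l
    using that Suc[of False "p \<noteq> q" "edge_child l"] by (cases p; cases q) simp_all
  show ?case
  proof (cases l "1/2 :: real" rule: linorder_cases)
    case equal
    \<comment> \<open>At the midpoint both orders of the ends take the first branch, and both give
      the average of the end values.\<close>
    have "edge_child (1/2) = 0" by (rule edge_child_half) simp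
    then show ?thesis unfolding equal by (cases p; cases q) (simp_all add: edge_height_ends)
  next
    case less
    then show ?thesis using *[of "1 - l" q p] by (simp del: edge_height.simps)
  next
    case greater
    then show ?thesis by (rule *)
  qed
qed simp

text \<open>This is packaged as a predicate because the argument is interleaved: at level
  \<open>m\<close> it makes the pieces of level \<open>Suc m\<close> agree, and that agreement is
  used to prove it at level \<open>Suc m\<close>.\<close>

definition edge_rule :: "nat \<Rightarrow> bool" where
  "edge_rule m \<longleftrightarrow> (\<forall>a j l. periodic a \<longrightarrow> 0 \<le> l \<longrightarrow> l \<le> 1 \<longrightarrow>
     height m a (l *\<^sub>R corner j + (1 - l) *\<^sub>R corner (j + 1)) = edge_height m (a j) (a (j + 1)) l)"

lemma height_sector:
  assumes "edge_rule m" "periodic a" "\<alpha> \<ge> 0" "\<beta> \<ge> 0" "\<alpha> + \<beta> \<ge> 1"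
    and "x = \<alpha> *\<^sub>R corner j + \<beta> *\<^sub>R corner (j + 1)"
  shows "height m a (retract x) = edge_height m (a j) (a (j + 1)) (\<alpha> / (\<alpha> + \<beta>))"
proof -
  have "0 \<le> \<alpha> / (\<alpha> + \<beta>)" "\<alpha> / (\<alpha> + \<beta>) \<le> 1" using assms by auto
  then show ?thesis
    using assms(1,2) unfolding assms(6) edge_rule_def retract_sector[OF assms(3-5)] by blast
qed

section \<open>Agreement of the pieces on the intersections of wedges\<close>

lemma piece_zero:
  assumes "edge_rule m" "periodic a"
  shows "piece m a k 0 = 1/2"
proof -
  \<comment> \<open>Seen from subcell \<open>k\<close>, the origin lies in the direction of the
    corner opposite to \<open>k\<close>, at the central hole.\<close>
  have "unF k 0 = (1 + sqrt 2) *\<^sub>R corner (k + 4) + 0 *\<^sub>R corner (k + 4 + 1)"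
    by (simp add: unF_def corner_add_4)
  from height_sector[OF assms(1) periodic_child _ _ _ this, of a k]
  show ?thesis using child_simps(5,6)[of a k] by (simp add: piece_def edge_height_refl add.assoc)
qed

text \<open>The common ray of the two wedges is a mirror axis that exchanges the two subcells. It
  passes through the notch, along the edge that the subcells share, and through the central hole;
  the two pieces are compared on each part.\<close>

lemma piece_adjacent:
  assumes m: "edge_rule m" "periodic a" and x: "x \<in> octagon" "x \<in> wedge k" "x \<in> wedge (k + 1)"
  shows "piece m a k x = piece m a (k + 1) x"
proof -
  obtain t where t: "t \<ge> 0" "x = t *\<^sub>R corner k + t *\<^sub>R corner (k + 1)"
    using wedge_Int_adjacent x by blast
  with x have "t + t \<le> 1" using octagon_sector_iff by blast
  then have t': "t \<le> 1/2" by simp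
  \<comment> \<open>Coordinates of \<open>unF k x\<close> along \<open>corner k\<close> and
    \<open>corner (k + 1)\<close>. For \<open>unF (k + 1) x\<close> they are exchanged.\<close>
  define B A where "B = (2 + sqrt 2) * t" and "A = B - (1 + sqrt 2)"
  have B: "B \<ge> 0" using t by (simp add: B_def)
  have "(2 + sqrt 2) * t \<le> (2 + sqrt 2) * (1/2)" using t' by (intro mult_left_mono) auto
  then have B': "B \<le> 1 + sqrt 2 / 2" by (simp add: B_def)
  then have A: "A \<le> - (sqrt 2 / 2)" by (simp add: A_def)
  then have "A \<le> 0" by (smt (verit) real_sqrt_gt_0_iff half_gt_zero)
  have y: "unF k x = A *\<^sub>R corner k + B *\<^sub>R corner (k + 1)"
    and y': "unF (k + 1) x = A *\<^sub>R corner (k + 1) + B *\<^sub>R corner k"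
    unfolding unF_def t(2) A_def B_def by (simp_all add: algebra_simps)
  have ind: "k + 1 + 1 = k + 2" "k + 2 + 1 = k + 3" "k + 3 + 1 = k + 4" "k + 4 + 1 = k + 5"
    "k + 5 + 1 = k + 6" "k + 6 + 1 = k + 7" "k + 7 + 1 = k + 8"
    "k + 1 + 5 = k + 6" "k + 1 + 4 = k + 5" "k + 1 + 6 = k + 7" "k + 1 + 7 = k + 8"
    by simp_all
  have c: "child a k (k + 1) \<longleftrightarrow> a k \<noteq> a (k + 1)" "child a k (k + 2) \<longleftrightarrow> a k \<noteq> a (k + 1)"
    "child a k (k + 3)" "child a k (k + 4)"
    "child a (k + 1) (k + 5)" "child a (k + 1) (k + 6)"
    "child a (k + 1) (k + 7) \<longleftrightarrow> a k \<noteq> a (k + 1)" "child a (k + 1) (k + 8) \<longleftrightarrow> a k \<noteq> a (k + 1)"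
    using child_simps[of a k] child_simps[of a "k + 1"] periodicD[OF m(2), of k]
    unfolding ind by auto
  note H = height_sector[OF m(1) periodic_child]
  have eq: "B + sqrt 2 * A = (1 + sqrt 2) * (A + 1)" "A + sqrt 2 * B = (1 + sqrt 2) * (B - 1)"
    by (simp_all add: A_def algebra_simps)
  \<comment> \<open>From the outside inwards: the notch, the shared edge, the central hole.\<close>
  consider "A \<ge> - 1" | "A \<le> - 1" "B \<ge> 1" | "B \<le> 1" by linarith
  then show ?thesis
  proof cases
    case 1
    then have nn: "B + sqrt 2 * A \<ge> 0" "- A \<ge> 0" using eq(1) \<open>A \<le> 0\<close> by auto
    have "(B + sqrt 2 * A) + (- A) = 1 + sqrt 2 * (1 + A)" by (simp add: A_def algebra_simps)
    moreover have "sqrt 2 * (1 + A) \<ge> 0" using 1 by simp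
    ultimately have ge: "(B + sqrt 2 * A) + (- A) \<ge> 1" "(- A) + (B + sqrt 2 * A) \<ge> 1" by linarith+
    have e: "unF k x = (B + sqrt 2 * A) *\<^sub>R corner (k + 1) + (- A) *\<^sub>R corner (k + 1 + 1)"
      unfolding y ind by (simp add: corner_simps prod_eq_iff algebra_simps)
    have e': "unF (k + 1) x = (- A) *\<^sub>R corner (k + 7) + (B + sqrt 2 * A) *\<^sub>R corner (k + 7 + 1)"
      unfolding y' ind by (simp add: corner_simps prod_eq_iff algebra_simps)
    show ?thesis
      unfolding piece_def H[OF nn ge(1) e] H[OF nn(2,1) ge(2) e'] ind c edge_height_refl
      by (simp add: flip_of_bool)
  next
    case 2
    define l where "l = A + sqrt 2 * B"
    have l': "- (B + sqrt 2 * A) = 1 - l"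
      unfolding l_def A_def by (simp add: algebra_simps)
    have nn: "l \<ge> 0" "1 - l \<ge> 0"
      using 2 eq unfolding l'[symmetric] by (auto simp: l_def mult_nonneg_nonpos)
    have ge: "l + (1 - l) \<ge> 1" "(1 - l) + l \<ge> 1" by auto
    have e: "unF k x = l *\<^sub>R corner (k + 2) + (1 - l) *\<^sub>R corner (k + 2 + 1)"
      unfolding y ind l'[symmetric] unfolding l_def by (simp add: corner_simps prod_eq_iff algebra_simps)
    have e': "unF (k + 1) x = (1 - l) *\<^sub>R corner (k + 6) + l *\<^sub>R corner (k + 6 + 1)"
      unfolding y' ind l'[symmetric] unfolding l_def by (simp add: corner_simps prod_eq_iff algebra_simps)
    have "piece m a k x = flip (a k) (edge_height m (a k \<noteq> a (k + 1)) True l)"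
      and "piece m a (k + 1) x = flip (a (k + 1)) (edge_height m True (a k \<noteq> a (k + 1)) (1 - l))"
      unfolding piece_def H[OF nn ge(1) e] H[OF nn(2,1) ge(2) e'] ind by (simp_all add: c)
    \<comment> \<open>If the values at corners \<open>k\<close> and \<open>k + 1\<close> differ, the
      shared edge has the constant value \<open>1/2\<close> from both sides. Otherwise both sides
      use the same \<open>flip\<close>, and the profiles are mirror images.\<close>
    then show ?thesis
      using edge_height_sym[of m True "a k \<noteq> a (k + 1)" "1 - l"]
      by (cases "a k = a (k + 1)") (auto simp: edge_height_refl)
  next
    case 3
    have "A + sqrt 2 * B \<le> 0" unfolding eq using 3 by (intro mult_nonneg_nonpos) auto
    then have nn: "- A - sqrt 2 * B \<ge> 0" by simp
    have "sqrt 2 * B \<le> sqrt 2 * 1" using 3 by (intro mult_left_mono) auto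
    then have ge: "B + (- A - sqrt 2 * B) \<ge> 1" "(- A - sqrt 2 * B) + B \<ge> 1"
      by (simp_all add: A_def)
    have e: "unF k x = B *\<^sub>R corner (k + 3) + (- A - sqrt 2 * B) *\<^sub>R corner (k + 3 + 1)"
      unfolding y ind by (simp add: corner_simps prod_eq_iff algebra_simps)
    have e': "unF (k + 1) x = (- A - sqrt 2 * B) *\<^sub>R corner (k + 5) + B *\<^sub>R corner (k + 5 + 1)"
      unfolding y' ind by (simp add: corner_simps prod_eq_iff algebra_simps)
    show ?thesis
      unfolding piece_def H[OF B nn ge(1) e] H[OF nn B ge(2) e'] ind
      by (simp add: c edge_height_refl)
  qed
qed

lemma piece_mod:
  assumes "periodic a"
  shows "piece m a (k mod 8) = piece m a k"
  by (rule ext)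
    (simp add: piece_def periodic_mod[OF assms] child_mod[OF assms] unF_def corner_mod)

text \<open>Wedges that are neither equal nor adjacent meet only at the origin, where every piece is
  \<open>1/2\<close>. Offset 7 is adjacency in the opposite order.\<close>

lemma piece_agree:
  assumes m: "edge_rule m" "periodic a" and x: "x \<in> octagon" "x \<in> wedge j" "x \<in> wedge k"
  shows "piece m a j x = piece m a k x"
proof -
  define d where "d = (k + 7 * j) mod 8"
  have k: "(j + d) mod 8 = k mod 8"
  proof -
    have "(j + d) mod 8 = (k + j * 8) mod 8" by (simp add: d_def mod_add_right_eq algebra_simps)
    then show ?thesis by simp
  qed
  then have wk: "x \<in> wedge (j + d)" using x(3) wedge_mod[of k] wedge_mod[of "j + d"] by simp
  have pk: "piece m a k = piece m a (j + d)"
    using k piece_mod[OF m(2), of m k] piece_mod[OF m(2), of m "j + d"] by simp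
  consider "d = 0" | "d = 1" | "d \<in> {2, 3, 4, 5, 6}" | "d = 7"
    using mod_less_divisor[of 8 "k + 7 * j"] unfolding d_def[symmetric] by force
  then show ?thesis
  proof cases
    case 2
    then show ?thesis using piece_adjacent[OF m x(1,2)] wk pk by simp
  next
    case 3
    then show ?thesis using wedge_Int_nonadjacent[OF x(2) wk] piece_zero[OF m, of j] piece_zero[OF m, of k] by simp
  next
    case 4
    have j: "(j + 7 + 1) mod 8 = j mod 8" by simp
    then have "x \<in> wedge (j + 7 + 1)"
      using x(2) wedge_mod[of j] wedge_mod[of "j + 7 + 1"] by simp
    then have "piece m a (j + 7) x = piece m a (j + 7 + 1) x"
      using piece_adjacent[OF m x(1)] wk 4 by simp
    then show ?thesis
      using pk 4 j piece_mod[OF m(2), of m j] piece_mod[OF m(2), of m "j + 7 + 1"] by simp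
  qed (simp add: pk)
qed

lemma height_Suc:
  assumes "edge_rule m" "periodic a" "x \<in> octagon" "x \<in> wedge k"
  shows "height (Suc m) a x = piece m a k x"
proof -
  define k' where "k' = (SOME k. k < 8 \<and> x \<in> wedge k)"
  have "k' < 8 \<and> x \<in> wedge k'" unfolding k'_def by (rule someI_ex) (rule wedge_cover)
  then have "piece m a k' x = piece m a k x" using piece_agree[OF assms(1-3)] assms(4) by blast
  then show ?thesis by (simp add: Let_def piece_def k'_def)
qed

text \<open>The half of the edge nearer to an end lies in the wedge of that end. After zooming, its
  points are either on an edge of the subcell, which matches the recursion of
  \<open>edge_height\<close>, or in the gap between the two subcells.\<close>

lemma edge_rule: "edge_rule m"
proof (induction m)
  case 0
  show ?case unfolding edge_rule_def
  proof (intro allI impI)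
    fix a j l assume "periodic a" "0 \<le> l" "l \<le> (1::real)"
    then show "height 0 a (l *\<^sub>R corner j + (1 - l) *\<^sub>R corner (j + 1)) = edge_height 0 (a j) (a (j + 1)) l"
      using sum_hat[of "\<lambda>i. of_bool (a i)" l "1 - l" _ j, OF _ _ _ refl] periodicD[of a] by simp
  qed
next
  case (Suc m)
  show ?case unfolding edge_rule_def
  proof (intro allI impI)
    fix a j l assume a: "periodic a" and l: "0 \<le> l" "l \<le> (1::real)"
    define x where "x = l *\<^sub>R corner j + (1 - l) *\<^sub>R corner (j + 1)"
    have x: "x \<in> octagon" unfolding x_def using l by (subst octagon_sector_iff) auto
    have ind: "j + 1 + 1 = j + 2" "j + 7 + 1 = j + 8" "j + 1 + 7 = j + 8" "j + 1 + 6 = j + 7"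
      by simp_all
    have c: "\<not> child a j j" "child a j (j + 1) \<longleftrightarrow> a j \<noteq> a (j + 1)" "child a j (j + 2) \<longleftrightarrow> a j \<noteq> a (j + 1)"
      "\<not> child a (j + 1) (j + 1)" "child a (j + 1) j \<longleftrightarrow> a j \<noteq> a (j + 1)"
      "child a (j + 1) (j + 7) \<longleftrightarrow> a j \<noteq> a (j + 1)" "child a (j + 1) (j + 8) \<longleftrightarrow> a j \<noteq> a (j + 1)"
      using child_simps[of a j] child_simps[of a "j + 1"] periodicD[OF a, of j]
        periodicD[OF periodic_child, of a "j + 1" j]
      unfolding ind by auto
    note H = height_sector[OF Suc periodic_child]
    \<comment> \<open>Both halves at once: \<open>t\<close> is the weight of the nearer end, which
      is \<open>corner j\<close> for \<open>y\<close> and \<open>corner (j + 1)\<close> for the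
      mirror image \<open>y'\<close>.\<close>
    have child: "height m (child a j) (retract y) = edge_height m False (a j \<noteq> a (j + 1)) (edge_child t)"
        "height m (child a (j + 1)) (retract y') = edge_height m (a j \<noteq> a (j + 1)) False (1 - edge_child t)"
      if t: "t \<ge> 1/2" "t \<le> 1"
        and y: "y = ((2 + sqrt 2) * t - (1 + sqrt 2)) *\<^sub>R corner j + ((2 + sqrt 2) * (1 - t)) *\<^sub>R corner (j + 1)"
        and y': "y' = ((2 + sqrt 2) * t - (1 + sqrt 2)) *\<^sub>R corner (j + 1) + ((2 + sqrt 2) * (1 - t)) *\<^sub>R corner j"
      for t y y'
    proof -
      define A where "A = (2 + sqrt 2) * t - (1 + sqrt 2)"
      have B: "(2 + sqrt 2) * (1 - t) = 1 - A" by (simp add: A_def algebra_simps)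
      have A1: "1 - A \<ge> 0" unfolding B[symmetric] using t by (intro mult_nonneg_nonneg) auto
      have ec: "edge_child t = max 0 A" by (simp add: edge_child_def A_def)
      have "height m (child a j) (retract y) = edge_height m False (a j \<noteq> a (j + 1)) (edge_child t) \<and>
        height m (child a (j + 1)) (retract y') = edge_height m (a j \<noteq> a (j + 1)) False (1 - edge_child t)"
      proof (cases "A \<ge> 0")
        case True
        then show ?thesis
          by (subst H[OF True A1 _ y[folded A_def, unfolded B]], simp)
            (subst H[OF A1 True _ y'[folded A_def, unfolded B add.commute[of "A *\<^sub>R corner (j + 1)"]]],
              simp_all add: ec c)
      next
        case False
        have "(2 + sqrt 2) * t \<ge> (2 + sqrt 2) * (1/2)" using t by (intro mult_left_mono) auto
        then have "A \<ge> - (sqrt 2 / 2)" by (simp add: A_def)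
        then have "(sqrt 2 - 1) * A \<ge> (sqrt 2 - 1) * - (sqrt 2 / 2)" by (intro mult_left_mono) auto
        moreover have "(sqrt 2 - 1) * - (sqrt 2 / 2) = sqrt 2 / 2 - 1" by (simp add: field_simps)
        moreover have "(sqrt 2 - 1) * A = sqrt 2 * A - A" by (simp add: algebra_simps)
        ultimately have "1 - A + sqrt 2 * A \<ge> sqrt 2 / 2" by linarith
        then have p: "1 - A + sqrt 2 * A \<ge> 0" using real_sqrt_ge_0_iff[of 2] by linarith
        have n: "- A \<ge> 0" using False by simp
        have "(2 - sqrt 2) * A \<le> 0"
          using False real_sqrt_less_iff[of 2 4] by (intro mult_nonneg_nonpos) (auto simp del: real_sqrt_less_iff)
        then have s: "(1 - A + sqrt 2 * A) + - A \<ge> 1" "- A + (1 - A + sqrt 2 * A) \<ge> 1"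
          by (simp_all add: algebra_simps)
        \<comment> \<open>In the gap the zoomed point is seen beyond an edge at the notch. Its ends
          have equal values, in accordance with the clipped parameter 0.\<close>
        have e: "y = (1 - A + sqrt 2 * A) *\<^sub>R corner (j + 1) + (- A) *\<^sub>R corner (j + 1 + 1)"
          unfolding y B A_def[symmetric] ind by (simp add: corner_simps prod_eq_iff algebra_simps)
        have e': "y' = (- A) *\<^sub>R corner (j + 7) + (1 - A + sqrt 2 * A) *\<^sub>R corner (j + 7 + 1)"
          unfolding y' B A_def[symmetric] ind by (simp add: corner_simps prod_eq_iff algebra_simps)
        have "edge_child t = 0" using False by (simp add: ec)
        then show ?thesis
          unfolding H[OF p n s(1) e] H[OF n p s(2) e'] ind
          by (simp add: c edge_height_refl edge_height_ends)
      qed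
      then show "height m (child a j) (retract y) = edge_height m False (a j \<noteq> a (j + 1)) (edge_child t)"
        "height m (child a (j + 1)) (retract y') = edge_height m (a j \<noteq> a (j + 1)) False (1 - edge_child t)"
        by auto
    qed
    have uj: "unF j x = ((2 + sqrt 2) * l - (1 + sqrt 2)) *\<^sub>R corner j + ((2 + sqrt 2) * (1 - l)) *\<^sub>R corner (j + 1)"
      and uj1: "unF (j + 1) x = ((2 + sqrt 2) * (1 - l) - (1 + sqrt 2)) *\<^sub>R corner (j + 1)
        + ((2 + sqrt 2) * (1 - (1 - l))) *\<^sub>R corner j"
      unfolding unF_def x_def by (simp_all add: prod_eq_iff algebra_simps)
    have nn: "(sqrt 2 - 1) * u \<ge> 0" if "u \<ge> 0" for u using that by simp
    show "height (Suc m) a x = edge_height (Suc m) (a j) (a (j + 1)) l"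
    proof (cases "l \<ge> 1/2")
      case True
      then have "x \<in> wedge j"
        unfolding x_def wedge_sector_iff using l nn[OF l(1)] by linarith
      then show ?thesis
        using height_Suc[OF Suc a x] child(1)[OF True l(2) uj refl] True by (simp add: piece_def)
    next
      case False
      then have "x \<in> wedge (j + 1)"
        unfolding x_def wedge_sector_iff using l nn[of "1 - l"] by linarith
      then show ?thesis
        using height_Suc[OF Suc a x] child(2)[OF _ _ refl uj1] False l by (simp add: piece_def)
    qed
  qed
qed

section \<open>Continuity of the height\<close>

lemma continuous_on_piece:
  assumes "\<And>b. periodic b \<Longrightarrow> continuous_on octagon (height m b)"
  shows "continuous_on S (piece m a k)"
proof -
  have "continuous_on S (\<lambda>x. retract (unF k x))"
    by (rule continuous_on_compose2[OF continuous_on_retract[of UNIV]])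
      (auto simp: unF_def intro!: continuous_intros)
  then have "continuous_on S (\<lambda>x. height m (child a k) (retract (unF k x)))"
    by (rule continuous_on_compose2[OF assms[OF periodic_child]])
      (auto simp: retract_in_octagon)
  then show ?thesis
    unfolding piece_def flip_def by (cases "a k") (auto intro!: continuous_intros)
qed

text \<open>The height is pasted from continuous pieces on the finitely many closed sets
  \<open>octagon \<inter> wedge k\<close>.\<close>

lemma continuous_on_height: "periodic a \<Longrightarrow> continuous_on octagon (height m a)"
proof (induction m arbitrary: a)
  case 0
  show ?case by (auto intro!: continuous_intros)
next
  case (Suc m)
  have "continuous_on (\<Union>k\<in>{..<8}. octagon \<inter> wedge k) (height (Suc m) a)"
  proof (rule continuous_on_closed_Union)
    fix k
    have "continuous_on (octagon \<inter> wedge k) (piece m a k)"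
      by (rule continuous_on_piece[OF Suc.IH])
    then show "continuous_on (octagon \<inter> wedge k) (height (Suc m) a)"
      by (rule continuous_on_eq) (use height_Suc[OF edge_rule Suc.prems] in auto)
  qed (auto simp: closed_octagon closed_wedge closed_Int)
  also have "(\<Union>k\<in>{..<8}. octagon \<inter> wedge k) = octagon" using wedge_cover by auto
  finally show ?case .
qed

section \<open>Values on the holes\<close>

lemma sector_cover_from:
  obtains d \<alpha> \<beta> where "d < 8" "\<alpha> \<ge> 0" "\<beta> \<ge> 0"
    "x = \<alpha> *\<^sub>R corner (k + d) + \<beta> *\<^sub>R corner (k + d + 1)"
proof -
  obtain i \<alpha> \<beta> where x: "\<alpha> \<ge> 0" "\<beta> \<ge> 0" "x = \<alpha> *\<^sub>R corner i + \<beta> *\<^sub>R corner (i + 1)"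
    by (rule sector_cover)
  define d where "d = (i + 7 * k) mod 8"
  have "(k + d) mod 8 = (i + k * 8) mod 8" by (simp add: d_def mod_add_right_eq algebra_simps)
  then have "(k + d) mod 8 = i mod 8" by simp
  then have "corner (k + d + e) = corner (i + e)" for e
    by (metis corner_mod mod_add_left_eq)
  from this[of 0] this[of 1] show thesis
    using that[of d, OF _ x(1,2)] x(3) by (simp add: d_def)
qed

lemma outside_octagon_sector:
  assumes "\<alpha> \<ge> 0" "\<beta> \<ge> 0" "\<alpha> *\<^sub>R corner j + \<beta> *\<^sub>R corner (j + 1) \<notin> octagon"
  shows "\<alpha> + \<beta> > 1"
  using octagon_sector_iff[OF assms(1,2)] assms(3) by force

text \<open>
  From the centre of its wedge's subcell, a point of the octagon outside all subcells is seen beyond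
  one of the four edges whose end points have equal values for every \<open>a\<close>.
\<close>

lemma height_beyond_cell:
  assumes a: "periodic a" and x: "x \<in> octagon" "x \<in> wedge k" and y: "unF k x \<notin> octagon"
  shows "height m (child a k) (retract (unF k x)) \<in> {0, 1}"
proof -
  obtain d \<alpha> \<beta> where d: "d < 8" and nn: "\<alpha> \<ge> 0" "\<beta> \<ge> 0"
    and e: "unF k x = \<alpha> *\<^sub>R corner (k + d) + \<beta> *\<^sub>R corner (k + d + 1)"
    by (rule sector_cover_from)
  have gt: "\<alpha> + \<beta> > 1" using outside_octagon_sector nn y unfolding e by blast
  have x_eq: "x = \<rho> *\<^sub>R unF k x + (1 - \<rho>) *\<^sub>R corner k"
    using F_eq F_unF by metis
  have \<rho>gt: "\<rho> * (\<alpha> + \<beta>) > \<rho>" using gt rho_simps by simp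
  have np: "0 \<le> \<rho> * \<alpha>" "0 \<le> \<rho> * \<beta>" "0 \<le> \<rho> * \<alpha> + (1 - \<rho>)" "0 \<le> \<rho> * \<beta> + (1 - \<rho>)"
    using nn rho_simps by simp_all
  \<comment> \<open>Beyond the edges \<open>k\<close> and \<open>k + 7\<close> of the subcell, which
    lie on the boundary of the octagon, \<open>x\<close> would be outside the octagon.\<close>
  have "d \<noteq> 0"
  proof
    assume "d = 0"
    then have "x = (\<rho> * \<alpha> + (1 - \<rho>)) *\<^sub>R corner k + (\<rho> * \<beta>) *\<^sub>R corner (k + 1)"
      by (subst x_eq) (simp add: e algebra_simps)
    with x(1) have "(\<rho> * \<alpha> + (1 - \<rho>)) + \<rho> * \<beta> \<le> 1"
      using octagon_sector_iff[OF np(3,2), of k] by simp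
    with \<rho>gt show False by (simp add: algebra_simps)
  qed
  moreover have "d \<noteq> 7"
  proof
    assume "d = 7"
    then have "x = (\<rho> * \<alpha>) *\<^sub>R corner (k + 7) + (\<rho> * \<beta> + (1 - \<rho>)) *\<^sub>R corner (k + 7 + 1)"
      by (subst x_eq) (simp add: e add.assoc corner_add_8 algebra_simps)
    with x(1) have "\<rho> * \<alpha> + (\<rho> * \<beta> + (1 - \<rho>)) \<le> 1"
      using octagon_sector_iff[OF np(1,4), of "k + 7"] by simp
    with \<rho>gt show False by (simp add: algebra_simps)
  qed
  \<comment> \<open>The wedge condition on \<open>x\<close>, rewritten for the zoomed point. It
    excludes the edges \<open>k + 2\<close> and \<open>k + 5\<close>, which lie on the sides of the
    wedge.\<close>
  moreover have w: "\<bar>unF k x \<bullet> corner (k + 2)\<bar> \<le> (sqrt 2 - 1) * (unF k x \<bullet> corner k) + 1"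
  proof -
    have 1: "corner k \<bullet> corner (k + 2) = 0" using inner_sector[of "corner k" 1 k 0] by simp
    have "\<bar>x \<bullet> corner (k + 2)\<bar> \<le> (sqrt 2 - 1) * (x \<bullet> corner k)"
      using x(2) by (simp add: wedge_def)
    moreover have "x \<bullet> corner (k + 2) = \<rho> * (unF k x \<bullet> corner (k + 2))"
      by (subst x_eq) (simp add: inner_add_left 1)
    moreover have "x \<bullet> corner k = \<rho> * (unF k x \<bullet> corner k + (1 + sqrt 2))"
    proof -
      have "x \<bullet> corner k = \<rho> * (unF k x \<bullet> corner k) + (1 - \<rho>)"
        by (subst x_eq) (simp add: inner_add_left inner_corner)
      then show ?thesis unfolding rho_simps(2)[symmetric] by (simp add: distrib_left)
    qed
    ultimately have "\<rho> * \<bar>unF k x \<bullet> corner (k + 2)\<bar>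
        \<le> \<rho> * ((sqrt 2 - 1) * (unF k x \<bullet> corner k + (1 + sqrt 2)))"
      using rho_simps(3) by (simp add: abs_mult mult.left_commute)
    then have "\<bar>unF k x \<bullet> corner (k + 2)\<bar> \<le> (sqrt 2 - 1) * (unF k x \<bullet> corner k + (1 + sqrt 2))"
      using rho_simps(3) by (simp only: mult_le_cancel_left_pos)
    then show ?thesis by (simp add: algebra_simps)
  qed
  have "d \<noteq> 2"
  proof
    assume "d = 2"
    note in2 = inner_sector[OF e, unfolded this]
    have i: "unF k x \<bullet> corner (k + 2) = \<alpha> + sqrt 2 / 2 * \<beta>"
      "unF k x \<bullet> corner k = - (sqrt 2 / 2 * \<beta>)"
      using in2 by (simp_all add: add.assoc corner_add_8)
    show False using order_trans[OF abs_ge_self w] gt unfolding i by (simp add: field_simps)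
  qed
  moreover have "d \<noteq> 5"
  proof
    assume "d = 5"
    note in2 = inner_sector[OF e, unfolded this]
    have "corner (k + 10) = corner (k + 2)" using corner_add_8[of "k + 2"] by (simp add: add.assoc)
    then have i: "unF k x \<bullet> corner (k + 2) = - (sqrt 2 / 2 * \<alpha>) - \<beta>"
      "unF k x \<bullet> corner k = - (sqrt 2 / 2 * \<alpha>)"
      using in2(4,6) by (simp_all add: add.assoc corner_add_8)
    show False using order_trans[OF abs_ge_minus_self w] gt unfolding i by (simp add: field_simps)
  qed
  ultimately have "d = 1 \<or> d = 3 \<or> d = 4 \<or> d = 6" using d by auto
  then have "child a k (k + d) = child a k (k + d + 1)"
    using child_simps[of a k] by (auto simp: add.assoc)
  then show ?thesis
    using height_sector[OF edge_rule periodic_child nn less_imp_le[OF gt] e, of m a k]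
    by (simp add: edge_height_refl)
qed

text \<open>At the level at which a point leaves the cells, the normalised height is 0 or 1, and
  each \<open>flip\<close> on the way back preserves rationality. Constancy on a hole will follow
  from this by connectedness.\<close>

lemma height_hole:
  assumes "periodic a" "x \<in> octagon" "x \<notin> cell_union m"
  shows "height m a x \<in> \<rat>"
  using assms
proof (induction m arbitrary: a x)
  case 0
  then show ?case by (simp add: cell_union_def words_def cell_def)
next
  case (Suc m)
  obtain k where k: "k < 8" "x \<in> wedge k" using wedge_cover by blast
  have "height m (child a k) (retract (unF k x)) \<in> \<rat>"
  proof (cases "unF k x \<in> octagon")
    case True
    have "unF k x \<notin> cell_union m"
    proof
      assume "unF k x \<in> cell_union m"
      then obtain w z where "w \<in> words m" "z \<in> octagon" "unF k x = F_word w z"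
        by (auto simp: cell_union_def cell_def)
      then have "k # w \<in> words (Suc m)" "x = F_word (k # w) z"
        using k F_unF[of k x] by (auto simp: words_def)
      then show False using Suc.prems(3) \<open>z \<in> octagon\<close> by (auto simp: cell_union_def cell_def)
    qed
    then show ?thesis using Suc.IH[OF periodic_child True] by (simp add: retract_octagon True)
  next
    case False
    then show ?thesis using height_beyond_cell[OF Suc.prems(1,2) k(2)] by (metis Rats_0 Rats_1 empty_iff insert_iff)
  qed
  then show ?case
    unfolding height_Suc[OF edge_rule Suc.prems(1,2) k(2)] piece_def flip_def by simp
qed

section \<open>The potential on the whole plane and its invariance under gluing\<close>

definition potential :: "nat \<Rightarrow> real \<times> real \<Rightarrow> real" where
  "potential m x = height m (\<lambda>_. False) (retract x)"

lemma periodic_False: "periodic (\<lambda>_. False)"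
  by (simp add: periodic_def)

lemma continuous_on_potential: "continuous_on S (potential m)"
  unfolding potential_def
  by (rule continuous_on_compose2[OF continuous_on_height[OF periodic_False] continuous_on_retract])
    (auto simp: retract_in_octagon)

text \<open>Outside the octagon \<open>retract\<close> leads to a boundary edge with both end values
  \<open>False\<close>, so the potential is 0 there.\<close>

lemma potential_hole:
  assumes "x \<notin> cell_union m"
  shows "potential m x \<in> \<rat>"
proof (cases "x \<in> octagon")
  case True
  then show ?thesis using height_hole[OF periodic_False] assms by (simp add: potential_def retract_octagon)
next
  case False
  obtain k \<alpha> \<beta> where x: "\<alpha> \<ge> 0" "\<beta> \<ge> 0" "x = \<alpha> *\<^sub>R corner k + \<beta> *\<^sub>R corner (k + 1)"
    by (rule sector_cover)
  then have "\<alpha> + \<beta> \<ge> 1" using outside_octagon_sector False by force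
  from height_sector[OF edge_rule periodic_False x(1,2) this x(3)]
  show ?thesis by (simp add: potential_def edge_height_refl)
qed

text \<open>The image of a hole is connected and, consisting of rationals, countable.\<close>

lemma potential_component:
  assumes H: "H \<in> components (- cell_union m)" and "x \<in> closure H" "y \<in> closure H"
  shows "potential m x = potential m y"
proof -
  have "potential m ` H \<subseteq> \<rat>"
    using in_components_subset[OF H] potential_hole by auto
  then have "countable (potential m ` H)" using countable_rat countable_subset by blast
  moreover have "connected (potential m ` H)"
    by (intro connected_continuous_image continuous_on_potential in_components_connected[OF H])
  ultimately have eq: "potential m u = potential m v" if "u \<in> H" "v \<in> H" for u v
    using connected_uncountable[of "potential m ` H"] that by (meson image_eqI)
  obtain u where "u \<in> H" using in_components_nonempty[OF H] by auto
  have "potential m z = potential m u" if "z \<in> closure H" for z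
    using continuous_constant_on_closure[OF continuous_on_potential _ that] eq \<open>u \<in> H\<close> by blast
  then show ?thesis using assms by metis
qed

text \<open>The point reflection maps \<open>H\<close> onto itself and hence its closure into
  itself, so \<open>x\<close> and \<open>y\<close> both lie in \<open>closure H\<close>.\<close>

lemma potential_antipodal:
  assumes "antipodal m x y"
  shows "potential m x = potential m y"
proof -
  obtain H c where H: "H \<in> components (- cell_union m)" "symmetric_about H c"
    and x: "x \<in> frontier H" and y: "y = 2 *\<^sub>R c - x"
    using assms by (auto simp: antipodal_def)
  have xH: "x \<in> closure H" using x by (simp add: frontier_def)
  have "(\<lambda>x. 2 *\<^sub>R c - x) ` closure H \<subseteq> closure H"
  proof (rule image_closure_subset)
    show "(\<lambda>x. 2 *\<^sub>R c - x) ` H \<subseteq> closure H"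
      using H(2) closure_subset by (auto simp: symmetric_about_def)
  qed (auto intro!: continuous_intros)
  then have "y \<in> closure H" using xH y by blast
  then show ?thesis using potential_component[OF H(1) xH] by blast
qed

lemma potential_glue:
  assumes "glue m x = glue m y"
  shows "potential m x = potential m y"
proof -
  have "y \<in> glue m y" by (simp add: glue_def)
  then have "equivclp (antipodal m) x y" unfolding assms[symmetric] by (simp add: glue_def)
  then show ?thesis
  proof (induction rule: equivclp_induct)
    case (step y z)
    then show ?case using potential_antipodal[of m y z] potential_antipodal[of m z y] by auto
  qed simp
qed

section \<open>Variation of the potential on cells and along paths\<close>

lemma height_0_range:
  assumes "periodic a" "z \<in> octagon"
  shows "0 \<le> height 0 a z" "height 0 a z \<le> 1"
proof -
  obtain j \<alpha> \<beta> where z: "\<alpha> \<ge> 0" "\<beta> \<ge> 0" "z = \<alpha> *\<^sub>R corner j + \<beta> *\<^sub>R corner (j + 1)"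
    by (rule sector_cover)
  then have "\<alpha> + \<beta> \<le> 1" using assms octagon_sector_iff by blast
  moreover have "height 0 a z = \<alpha> * of_bool (a j) + \<beta> * of_bool (a (j + 1))"
    using sum_hat[of "\<lambda>i. of_bool (a i)", OF _ z] periodicD[OF assms(1)] by simp
  ultimately show "0 \<le> height 0 a z" "height 0 a z \<le> 1" using z by auto
qed

lemma F_word_in_octagon: "z \<in> octagon \<Longrightarrow> F_word w z \<in> octagon"
  by (induction w) (auto simp: F_in_octagon)

lemma height_F:
  assumes "periodic a" "z \<in> octagon"
  shows "height (Suc m) a (F k z) = flip (a k) (height m (child a k) z)"
  using height_Suc[OF edge_rule assms(1) F_in_octagon[OF assms(2)] F_in_wedge[OF assms(2)]]
  by (simp add: piece_def unF_F retract_octagon assms)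

lemma flip_diff: "\<bar>flip p u - flip p v\<bar> = \<bar>u - v\<bar> / 2"
  by (simp add: flip_def abs_if)

text \<open>Each letter of the word contributes one \<open>flip\<close>, which halves differences;
  at level 0 the height stays in the unit interval.\<close>

lemma height_cell:
  assumes "periodic a" "z \<in> octagon" "z' \<in> octagon"
  shows "\<bar>height (length w) a (F_word w z) - height (length w) a (F_word w z')\<bar> \<le> 1 / 2 ^ length w"
  using assms(1)
proof (induction w arbitrary: a)
  case Nil
  then show ?case
    using height_0_range[OF Nil assms(2)] height_0_range[OF Nil assms(3)] by simp
next
  case (Cons k w)
  have "height (length (k # w)) a (F_word (k # w) u)
      = flip (a k) (height (length w) (child a k) (F_word w u))" if "u \<in> octagon" for u
    using height_F[OF Cons.prems F_word_in_octagon[OF that]] by simp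
  then show ?case
    using Cons.IH[OF periodic_child, of a k] assms(2,3)
    by (simp only: flip_diff) (simp add: field_simps)
qed

lemma potential_cell:
  assumes "w \<in> words m" "x \<in> cell w" "y \<in> cell w"
  shows "\<bar>potential m x - potential m y\<bar> \<le> 1 / 2 ^ m"
  using assms height_cell[OF periodic_False, of _ _ w]
  by (auto simp: words_def cell_def potential_def retract_octagon F_word_in_octagon)

lemma cell_edge_subset: "cell_edge w i \<subseteq> cell w"
  unfolding cell_edge_def cell_def octagon_edge_def
  by (intro image_mono closed_segment_subset corner_in_octagon convex_octagon)

lemma potential_adjacent:
  assumes "adjacent m w v"
  obtains x y where "x \<in> cell w" "y \<in> cell v" "potential m x = potential m y"
proof -
  obtain i j where e: "glue m ` cell_edge w i = glue m ` cell_edge v j"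
    using assms by (auto simp: adjacent_def)
  define x where "x = F_word w (corner i)"
  have x: "x \<in> cell_edge w i" by (simp add: x_def cell_edge_def octagon_edge_def)
  then have "glue m x \<in> glue m ` cell_edge v j" using e by blast
  then obtain y where "y \<in> cell_edge v j" "glue m x = glue m y" by auto
  then show thesis using that x cell_edge_subset potential_glue by blast
qed

text \<open>Each cell of the path contributes at most \<open>1 / 2 ^ m\<close>. The passage to the
  next cell is free, since adjacent cells contain points of equal potential.\<close>

lemma potential_path:
  assumes "successively (adjacent m) cs" "cs \<noteq> []" "set cs \<subseteq> words m"
    and "x \<in> cell (hd cs)" "y \<in> cell (last cs)"
  shows "\<bar>potential m x - potential m y\<bar> \<le> real (length cs) / 2 ^ m"
  using assms
proof (induction cs arbitrary: x)
  case (Cons w cs)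
  show ?case
  proof (cases cs)
    case Nil
    then show ?thesis using potential_cell[of w m x y] Cons.prems by simp
  next
    case [simp]: (Cons v cs')
    have "adjacent m w v" using Cons.prems by simp
    then obtain u z where u: "u \<in> cell w" "z \<in> cell v" "potential m u = potential m z"
      by (rule potential_adjacent)
    have "\<bar>potential m x - potential m u\<bar> \<le> 1 / 2 ^ m"
      using potential_cell[of w m x u] u Cons.prems by simp
    moreover have "\<bar>potential m z - potential m y\<bar> \<le> real (length cs) / 2 ^ m"
      using Cons.IH[of z] Cons.prems u by simp
    ultimately show ?thesis using u(3) by (simp add: add_divide_distrib)
  qed
qed simp

section \<open>Values at an outer corner and at the central hole\<close>

lemma F_corner: "F k (corner k) = corner k"
  by (simp add: F_eq flip: scaleR_add_left)

lemma F_word_replicate_corner: "F_word (replicate n k) (corner k) = corner k"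
  by (induction n) (simp_all add: F_corner)

lemma height_corner: "periodic a \<Longrightarrow> height m a (corner j) = of_bool (a j)"
  using edge_rule[of m, unfolded edge_rule_def, rule_format, of a 1 j] by (simp add: edge_height_ends)

lemma potential_corner: "potential m (corner j) = 0"
  by (simp add: potential_def retract_octagon corner_in_octagon height_corner periodic_False)

lemma potential_inner_corner: "potential (Suc n) (F 0 (corner 4)) = 1/2"
  using child_simps(5)[of "\<lambda>_. False" 0]
  by (simp add: potential_def retract_octagon F_in_octagon corner_in_octagon height_F periodic_False
      height_corner periodic_child del: height.simps)

section \<open>Paths\<close>

text \<open>Coincidence of edges in the plane, before any identification. It persists when the same
  letter is put in front of both words, whereas \<open>glue\<close> depends on the level.\<close>

definition shares_edge :: "nat \<Rightarrow> nat list \<Rightarrow> nat list \<Rightarrow> bool" where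
  "shares_edge m w v \<longleftrightarrow> w \<in> words m \<and> v \<in> words m \<and> (\<exists>i j. cell_edge w i = cell_edge v j)"

lemma octagon_edge_mod: "octagon_edge (i mod 8) = octagon_edge i"
  unfolding octagon_edge_def corner_mod Suc_eq_plus1 by (metis corner_mod mod_add_left_eq)

lemma shares_edge_adjacent:
  assumes "shares_edge m w v" "w \<noteq> v"
  shows "adjacent m w v"
proof -
  obtain i j where "cell_edge w i = cell_edge v j" using assms by (auto simp: shares_edge_def)
  then have "cell_edge w (i mod 8) = cell_edge v (j mod 8)"
    by (simp add: cell_edge_def octagon_edge_mod)
  then show ?thesis
    using assms unfolding adjacent_def shares_edge_def by (metis mod_less_divisor zero_less_numeral)
qed

lemma F_closed_segment: "F k ` closed_segment x y = closed_segment (F k x) (F k y)"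
proof -
  have "F k ` closed_segment x y = (+) ((1 - \<rho>) *\<^sub>R corner k) ` (*\<^sub>R) \<rho> ` closed_segment x y"
    unfolding image_image by (rule image_cong) (simp_all add: F_eq add.commute)
  also have "\<dots> = closed_segment ((1 - \<rho>) *\<^sub>R corner k + \<rho> *\<^sub>R x) ((1 - \<rho>) *\<^sub>R corner k + \<rho> *\<^sub>R y)"
    by (simp only: closed_segment_translation closed_segment_linear_image[OF linear_scaleR])
  finally show ?thesis by (simp add: F_eq add.commute)
qed

lemma image_F_word_Cons: "F_word (k # w) ` S = F k ` F_word w ` S"
  by (simp add: image_image)

lemma F_word_closed_segment: "F_word w ` closed_segment x y = closed_segment (F_word w x) (F_word w y)"
  by (induction w) (simp, simp only: image_F_word_Cons F_closed_segment, simp)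

lemma F_mod: "F (k mod 8) = F k"
  by (rule ext) (simp add: F_eq corner_mod)

lemma F_word_replicate: "F_word (replicate n k) x = corner k + \<rho> ^ n *\<^sub>R (x - corner k)"
proof (induction n)
  case (Suc n)
  have "F_word (replicate (Suc n) k) x = F k (corner k + \<rho> ^ n *\<^sub>R (x - corner k))"
    by (simp add: Suc)
  then show ?case by (simp add: F_eq algebra_simps)
qed simp

lemma words_Cons: "k # w \<in> words (Suc m) \<longleftrightarrow> k < 8 \<and> w \<in> words m"
  by (auto simp: words_def)

lemma shares_edge_Cons:
  assumes "(shares_edge m)\<^sup>*\<^sup>* w v" "k < 8"
  shows "(shares_edge (Suc m))\<^sup>*\<^sup>* (k # w) (k # v)"
  using assms(1)
proof induction
  case (step u v)
  then have "shares_edge (Suc m) (k # u) (k # v)"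
    using assms(2) unfolding shares_edge_def words_Cons cell_edge_def image_F_word_Cons by metis
  with step.IH show ?case by (rule rtranclp.rtrancl_into_rtrancl)
qed simp

text \<open>The subcells \<open>k\<close> and \<open>k + 1\<close> share an edge with the notch
  \<open>F k (corner (k + 2)) = F (k + 1) (corner (k + 7))\<close> as an end. The repeated letters
  shrink both subcells towards this point by the same factor, so the small edges still
  coincide.\<close>

lemma shares_edge_neighbour:
  assumes "k < 8"
  shows "shares_edge (Suc m) (k # replicate m ((k + 2) mod 8))
     ((k + 1) mod 8 # replicate m ((k + 7) mod 8))"
proof -
  have "F k (F_word (replicate m ((k + 2) mod 8)) (corner (k + 2)))
      = F (k + 1) (F_word (replicate m ((k + 7) mod 8)) (corner (k + 7)))"
    unfolding F_word_replicate corner_mod F_def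
    by (simp add: corner_simps prod_eq_iff algebra_simps)
  moreover have "F k (F_word (replicate m ((k + 2) mod 8)) (corner (k + 3)))
      = F (k + 1) (F_word (replicate m ((k + 7) mod 8)) (corner (k + 6)))"
    unfolding F_word_replicate corner_mod F_def
    by (simp add: corner_simps prod_eq_iff algebra_simps)
  ultimately have "cell_edge (k # replicate m ((k + 2) mod 8)) (k + 2)
     = cell_edge ((k + 1) mod 8 # replicate m ((k + 7) mod 8)) (k + 6)"
    unfolding cell_edge_def octagon_edge_def F_word_closed_segment
    by (simp add: F_mod closed_segment_commute Suc_eq_plus1 add.assoc)
  then show ?thesis
    using assms unfolding shares_edge_def words_Cons by (auto simp: words_def)
qed

text \<open>By induction all words with the same first letter are connected, and
  \<open>shares_edge_neighbour\<close> links the blocks of consecutive letters.\<close>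

lemma shares_edge_connected:
  assumes "w \<in> words m" "v \<in> words m"
  shows "(shares_edge m)\<^sup>*\<^sup>* w v"
  using assms
proof (induction m arbitrary: w v)
  case 0
  then show ?case by (simp add: words_def)
next
  case (Suc m)
  have sym: "symp (shares_edge (Suc m))\<^sup>*\<^sup>*"
    by (intro symp_rtranclp sympI) (metis shares_edge_def)
  have rep: "replicate m (i mod 8) \<in> words m" for i by (auto simp: words_def)
  have "(shares_edge (Suc m))\<^sup>*\<^sup>* (0 # replicate m 0) (k # u)" if "k < 8" "u \<in> words m" for k u
    using that
  proof (induction k arbitrary: u)
    case 0
    then show ?case using shares_edge_Cons[OF Suc.IH] rep[of 0] by simp
  next
    case (Suc k)
    have "(shares_edge (Suc m))\<^sup>*\<^sup>* (0 # replicate m 0) (k # replicate m ((k + 2) mod 8))"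
      using Suc rep by simp
    also have "shares_edge (Suc m) \<dots> ((k + 1) mod 8 # replicate m ((k + 7) mod 8))"
      using shares_edge_neighbour[of k m] Suc.prems(1) by simp
    also have "(k + 1) mod 8 = Suc k" using Suc by simp
    also have "(shares_edge (Suc m))\<^sup>*\<^sup>* (Suc k # replicate m ((k + 7) mod 8)) (Suc k # u)"
      using shares_edge_Cons[OF
          \<open>\<And>v w. w \<in> words m \<Longrightarrow> v \<in> words m \<Longrightarrow> (shares_edge m)\<^sup>*\<^sup>* w v\<close>] rep Suc by simp
    finally show ?case .
  qed
  then have "(shares_edge (Suc m))\<^sup>*\<^sup>* (0 # replicate m 0) u" if "u \<in> words (Suc m)" for u
    using that by (cases u) (auto simp: words_def)
  with Suc.prems sym show ?case by (meson sympD rtranclp_trans)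
qed

text \<open>\<open>cell_dist\<close> is a \<open>LEAST\<close>, which is attained by a path only if
  some path exists. Repeated words are skipped because \<open>adjacent\<close> demands distinct
  cells.\<close>

lemma path_exists:
  assumes "w \<in> words m" "v \<in> words m"
  shows "\<exists>n cs. path_of_length m n cs \<and> hd cs = w \<and> last cs = v"
  using shares_edge_connected[OF assms] assms(2)
proof (induction rule: converse_rtranclp_induct)
  case base
  then have "path_of_length m 0 [v]" by (simp add: path_of_length_def)
  then show ?case by force
next
  case (step w u)
  then obtain n cs where cs: "path_of_length m n cs" "hd cs = u" "last cs = v" by blast
  show ?case
  proof (cases "w = u")
    case False
    then have "adjacent m w u" using step shares_edge_adjacent by blast
    moreover have "w \<in> words m" using step by (simp add: shares_edge_def)
    ultimately have "path_of_length m (Suc n) (w # cs)" "last (w # cs) = v"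
      using cs by (auto simp: path_of_length_def successively_Cons)
    then show ?thesis by force
  qed (use cs in blast)
qed

theorem proposition9p4:
  fixes m :: nat
  assumes "m > 0"
  shows "diam m \<ge> 2 ^ (m - 1) - 1"
proof -
  obtain n where m: "m = Suc n" using assms by (cases m) auto
  \<comment> \<open>\<open>w\<close> is the cell at the outer corner 0, where the potential is 0;
    \<open>v\<close> lies at the central hole, at the point \<open>F 0 (corner 4)\<close> of
    potential \<open>1/2\<close>.\<close>
  define w where "w = replicate m (0::nat)"
  define v where "v = 0 # replicate n (4::nat)"
  have wv: "w \<in> words m" "v \<in> words m" by (auto simp: w_def v_def words_def m)
  have "\<exists>cs. path_of_length m (cell_dist m w v) cs \<and> hd cs = w \<and> last cs = v"
    unfolding cell_dist_def by (rule LeastI_ex) (rule path_exists[OF wv])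
  then obtain cs where cs: "path_of_length m (cell_dist m w v) cs" "hd cs = w" "last cs = v" by blast
  have "corner 0 \<in> cell w"
    unfolding cell_def w_def by (metis F_word_replicate_corner corner_in_octagon imageI)
  moreover have "F 0 (corner 4) \<in> cell v"
    unfolding cell_def v_def
    by (rule image_eqI[OF _ corner_in_octagon[of 4]]) (simp add: F_word_replicate_corner)
  ultimately have "\<bar>potential m (corner 0) - potential m (F 0 (corner 4))\<bar> \<le> real (length cs) / 2 ^ m"
    using cs by (intro potential_path) (auto simp: path_of_length_def)
  then have "1 / 2 \<le> real (length cs) / 2 ^ m"
    by (simp add: potential_corner potential_inner_corner m)
  then have "real (2 ^ n) \<le> real (length cs)" by (simp add: m pos_le_divide_eq)
  \<comment> \<open>A path of length \<open>n\<close> visits \<open>n + 1\<close> cells, whence the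
    subtraction of 1 in the bound.\<close>
  then have "2 ^ n \<le> Suc (cell_dist m w v)"
    using cs(1) by (simp only: of_nat_le_iff path_of_length_def)
  moreover have "cell_dist m w v \<le> diam m"
    unfolding diam_def
  proof (rule Max_ge)
    have "finite (words m)"
      using finite_lists_length_eq[of "{..<8::nat}" m] by (simp add: words_def conj_commute)
    moreover have "{cell_dist m w v |w v. w \<in> words m \<and> v \<in> words m}
        = (\<lambda>(w, v). cell_dist m w v) ` (words m \<times> words m)" by auto
    ultimately show "finite {cell_dist m w v |w v. w \<in> words m \<and> v \<in> words m}" by simp
  qed (use wv in blast)
  ultimately show ?thesis by (simp add: m)
qed

end
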